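(* Let $X=\mathbb{R}\times(0,\infty)$ be the open upper half-plane with the Euclidean metric and let $b=(0,0)$. Let $\rho:(0,\infty)\to(0,\infty)$ be a Borel measurable function with $\int_0^\infty\rho(t)\,dt<\infty$. Assume that $\rho$ is bounded and quasidecreasing, and that $$\inf_{r>0}\frac{\int_r^\infty\rho(t)\,dt}{(r+1)\rho(r)}=0.$$ Then $X$ with the Euclidean metric is $\frac{\pi}{2}$-uniform, but the space $(X,d_\rho)$ is not uniform.
   Context: Here $|x|:=d(b,x)$ with $d$ the Euclidean metric. The function $\rho$ is quasidecreasing if there is a constant $C\ge1$ with $\rho(t)\le C\rho(s)$ whenever $0<s\le t$. A curve is a continuous map $\gamma$ from a compact interval; its length with respect to a metric is the supremum of sums of consecutive distances over partitions, and it is rectifiable if its length is finite. The sphericalized metric is $d_\rho(x,y)=\inf_\gamma\int_\gamma\rho(|\cdot|)\,ds$, the infimum over all curves in $X$, rectifiable with respect to $d$, with end points $x,y$; $ds$ is arc length with respect to $d$. For a metric space $(Z,d_Z)$ let $\overline Z$ be its completion and $\partial Z=\overline Z\setminus Z$. For $C_U\ge1$, a curve $\gamma:[s,u]\to\overline Z$ connecting $x$ to $y$ is $C_U$-uniform in $(Z,d_Z)$ if (i) $\ell_{d_Z}(\gamma)\le C_Ud_Z(x,y)$ and (ii) $\min\{\ell_{d_Z}(\gamma|_{[s,t]}),\ell_{d_Z}(\gamma|_{[t,u]})\}\le C_U\inf_{w\in\partial Z}d_Z(\gamma(t),w)$ for every $t\in[s,u]$. $(Z,d_Z)$ is $C_U$-uniform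 if it is locally compact, not complete, and any two points of $Z$ can be connected by a curve in $Z$ that is $C_U$-uniform in $(Z,d_Z)$; it is uniform if it is $C_U$-uniform for some $C_U\ge1$. *)

theory Defs
  imports "HOL-Analysis.Analysis"
begin

section \<open>Curves, length and line integrals in a metric space\<close>

context Metric_space
begin

text \<open>A function on the reals represents a curve through its restriction to \<open>{s..u}\<close>;
  continuity into \<^term>\<open>mtopology\<close> includes that the curve stays in \<^term>\<open>M\<close> there.\<close>

definition curve :: "real \<Rightarrow> real \<Rightarrow> (real \<Rightarrow> 'a) \<Rightarrow> bool" where
  "curve s u \<gamma> \<longleftrightarrow> s \<le> u \<and> continuous_map (top_of_set {s..u}) mtopology \<gamma>"

definition curve_length :: "real \<Rightarrow> real \<Rightarrow> (real \<Rightarrow> 'a) \<Rightarrow> ennreal" where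
  "curve_length s u \<gamma> =
     (SUP (n, t) \<in> {(n :: nat, t :: nat \<Rightarrow> real). t 0 = s \<and> t n = u \<and> mono_on {..n} t}.
        \<Sum>i<n. ennreal (d (\<gamma> (t i)) (\<gamma> (t (Suc i)))))"

definition rectifiable :: "real \<Rightarrow> real \<Rightarrow> (real \<Rightarrow> 'a) \<Rightarrow> bool" where
  "rectifiable s u \<gamma> \<longleftrightarrow> curve_length s u \<gamma> < \<infinity>"

text \<open>The point reached after arc length \<open>r\<close>. For a rectifiable curve, any two parameters
  with the same arc length from the start are mapped to the same point, so the choice
  made by \<^const>\<open>inv_into\<close> is irrelevant.\<close>

definition arc_length_param :: "real \<Rightarrow> real \<Rightarrow> (real \<Rightarrow> 'a) \<Rightarrow> real \<Rightarrow> 'a" where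
  "arc_length_param s u \<gamma> r = \<gamma> (inv_into {s..u} (\<lambda>t. curve_length s t \<gamma>) (ennreal r))"

definition line_integral :: "('a \<Rightarrow> real) \<Rightarrow> real \<Rightarrow> real \<Rightarrow> (real \<Rightarrow> 'a) \<Rightarrow> ennreal" where
  "line_integral f s u \<gamma> =
     (\<integral>\<^sup>+ r \<in> {0..enn2real (curve_length s u \<gamma>)}. ennreal (f (arc_length_param s u \<gamma> r)) \<partial>lborel)"

text \<open>The base point \<open>b\<close> need not belong to \<^term>\<open>M\<close> (it may be a boundary point);
  \<^term>\<open>d\<close> is a function on the whole ambient type.\<close>

definition sphericalized_dist :: "'a \<Rightarrow> (real \<Rightarrow> real) \<Rightarrow> 'a \<Rightarrow> 'a \<Rightarrow> real" where
  "sphericalized_dist b \<rho> x y =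
     enn2real (INF (s, u, \<gamma>) \<in> {(s, u, \<gamma>). curve s u \<gamma> \<and> rectifiable s u \<gamma> \<and> \<gamma> s = x \<and> \<gamma> u = y}.
       line_integral (\<lambda>z. \<rho> (d b z)) s u \<gamma>)"

end


section \<open>Completion and boundary\<close>

text \<open>The completion consists of the equivalence classes of Cauchy sequences.\<close>

context Metric_space
begin

definition Cauchy_rel :: "((nat \<Rightarrow> 'a) \<times> (nat \<Rightarrow> 'a)) set" where
  "Cauchy_rel = {(\<sigma>, \<tau>). MCauchy \<sigma> \<and> MCauchy \<tau> \<and> (\<lambda>n. d (\<sigma> n) (\<tau> n)) \<longlonglongrightarrow> 0}"

definition completion :: "(nat \<Rightarrow> 'a) set set" where
  "completion = {\<sigma>. MCauchy \<sigma>} // Cauchy_rel"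

text \<open>The value \<open>0\<close> outside \<^term>\<open>completion\<close> only serves the axioms of \<^locale>\<open>Metric_space\<close>,
  which require symmetry and nonnegativity on the whole type.\<close>

definition completion_dist :: "(nat \<Rightarrow> 'a) set \<Rightarrow> (nat \<Rightarrow> 'a) set \<Rightarrow> real" where
  "completion_dist A B =
     (if A \<in> completion \<and> B \<in> completion
      then lim (\<lambda>n. d ((SOME \<sigma>. \<sigma> \<in> A) n) ((SOME \<tau>. \<tau> \<in> B) n)) else 0)"

definition completion_embed :: "'a \<Rightarrow> (nat \<Rightarrow> 'a) set" where
  "completion_embed x = Cauchy_rel `` {\<lambda>_. x}"

definition metric_boundary :: "(nat \<Rightarrow> 'a) set set" where
  "metric_boundary = completion - completion_embed ` M"

lemma equiv_Cauchy_rel: "equiv {\<sigma>. MCauchy \<sigma>} Cauchy_rel"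
proof (rule equivI)
  show "Cauchy_rel \<subseteq> {\<sigma>. MCauchy \<sigma>} \<times> {\<sigma>. MCauchy \<sigma>}"
    by (auto simp: Cauchy_rel_def)
  show "refl_on {\<sigma>. MCauchy \<sigma>} Cauchy_rel"
    by (auto simp: Cauchy_rel_def refl_on_def MCauchy_def image_subset_iff)
  show "sym Cauchy_rel"
    by (auto simp: Cauchy_rel_def sym_def commute)
  show "trans Cauchy_rel"
  proof (rule transI)
    fix \<sigma> \<tau> \<upsilon> assume 1: "(\<sigma>, \<tau>) \<in> Cauchy_rel" and 2: "(\<tau>, \<upsilon>) \<in> Cauchy_rel"
    then have M: "\<sigma> n \<in> M" "\<tau> n \<in> M" "\<upsilon> n \<in> M" for n
      by (auto simp: Cauchy_rel_def MCauchy_def)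
    have "(\<lambda>n. d (\<sigma> n) (\<tau> n) + d (\<tau> n) (\<upsilon> n)) \<longlonglongrightarrow> 0"
      using 1 2 by (auto simp: Cauchy_rel_def intro: tendsto_add_zero)
    then have "(\<lambda>n. d (\<sigma> n) (\<upsilon> n)) \<longlonglongrightarrow> 0"
      by (rule tendsto_sandwich[rotated 2, OF tendsto_const]) (auto intro!: always_eventually triangle M)
    with 1 2 show "(\<sigma>, \<upsilon>) \<in> Cauchy_rel" by (auto simp: Cauchy_rel_def)
  qed
qed

lemma MCauchy_dist_convergent:
  assumes "MCauchy \<sigma>" "MCauchy \<tau>"
  shows "convergent (\<lambda>n. d (\<sigma> n) (\<tau> n))"
proof -
  have M: "\<sigma> n \<in> M" "\<tau> n \<in> M" for n using assms by (auto simp: MCauchy_def)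
  have "Cauchy (\<lambda>n. d (\<sigma> n) (\<tau> n))"
  proof (rule metric_CauchyI)
    fix e :: real assume "e > 0"
    then have "e / 2 > 0" by simp
    with assms obtain N1 N2
      where N1: "\<And>n n'. N1 \<le> n \<Longrightarrow> N1 \<le> n' \<Longrightarrow> d (\<sigma> n) (\<sigma> n') < e / 2"
        and N2: "\<And>n n'. N2 \<le> n \<Longrightarrow> N2 \<le> n' \<Longrightarrow> d (\<tau> n) (\<tau> n') < e / 2"
      unfolding MCauchy_def by meson
    have "dist (d (\<sigma> m) (\<tau> m)) (d (\<sigma> n) (\<tau> n)) < e" if "m \<ge> max N1 N2" "n \<ge> max N1 N2" for m n
    proof -
      have "d (\<sigma> m) (\<sigma> n) < e / 2" "d (\<tau> m) (\<tau> n) < e / 2"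
        using that N1 N2 by auto
      moreover have "d (\<sigma> m) (\<tau> m) \<le> d (\<sigma> m) (\<sigma> n) + (d (\<sigma> n) (\<tau> n) + d (\<tau> m) (\<tau> n))"
        using triangle[of "\<sigma> m" "\<sigma> n" "\<tau> m"] triangle[of "\<sigma> n" "\<tau> n" "\<tau> m"] M commute[of "\<tau> m" "\<tau> n"]
        by auto
      moreover have "d (\<sigma> n) (\<tau> n) \<le> d (\<sigma> m) (\<sigma> n) + (d (\<sigma> m) (\<tau> m) + d (\<tau> m) (\<tau> n))"
        using triangle[of "\<sigma> n" "\<sigma> m" "\<tau> n"] triangle[of "\<sigma> m" "\<tau> m" "\<tau> n"] M commute[of "\<sigma> m" "\<sigma> n"]
        by auto
      ultimately show ?thesis by (simp add: dist_real_def)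
    qed
    then show "\<exists>K. \<forall>m\<ge>K. \<forall>n\<ge>K. dist (d (\<sigma> m) (\<tau> m)) (d (\<sigma> n) (\<tau> n)) < e" by blast
  qed
  then show ?thesis by (simp add: Cauchy_convergent_iff)
qed

lemma completion_dist_lim:
  assumes "A \<in> completion" "B \<in> completion" "\<sigma> \<in> A" "\<tau> \<in> B"
  shows "(\<lambda>n. d (\<sigma> n) (\<tau> n)) \<longlonglongrightarrow> completion_dist A B"
proof -
  define \<sigma>' where "\<sigma>' = (SOME \<sigma>. \<sigma> \<in> A)"
  define \<tau>' where "\<tau>' = (SOME \<tau>. \<tau> \<in> B)"
  have "\<sigma>' \<in> A" "\<tau>' \<in> B"
    unfolding \<sigma>'_def \<tau>'_def using assms by (metis someI)+
  then have rel: "(\<sigma>, \<sigma>') \<in> Cauchy_rel" "(\<tau>, \<tau>') \<in> Cauchy_rel"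
    using assms quotient_eq_iff[OF equiv_Cauchy_rel] unfolding completion_def by blast+
  then have C: "MCauchy \<sigma>" "MCauchy \<tau>" "MCauchy \<sigma>'" "MCauchy \<tau>'"
    and z: "(\<lambda>n. d (\<sigma> n) (\<sigma>' n) + d (\<tau> n) (\<tau>' n)) \<longlonglongrightarrow> 0"
    by (auto simp: Cauchy_rel_def intro: tendsto_add_zero)
  then have M: "\<sigma> n \<in> M" "\<tau> n \<in> M" "\<sigma>' n \<in> M" "\<tau>' n \<in> M" for n
    by (auto simp: MCauchy_def)
  have lim': "(\<lambda>n. d (\<sigma>' n) (\<tau>' n)) \<longlonglongrightarrow> completion_dist A B"
    using MCauchy_dist_convergent[OF C(3,4)]
    by (simp add: completion_dist_def assms(1,2) \<sigma>'_def \<tau>'_def convergent_LIMSEQ_iff)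
  have "\<bar>d (\<sigma> n) (\<tau> n) - d (\<sigma>' n) (\<tau>' n)\<bar> \<le> d (\<sigma> n) (\<sigma>' n) + d (\<tau> n) (\<tau>' n)" for n
  proof -
    have "d (\<sigma> n) (\<tau> n) \<le> d (\<sigma> n) (\<sigma>' n) + (d (\<sigma>' n) (\<tau>' n) + d (\<tau> n) (\<tau>' n))"
      using triangle[of "\<sigma> n" "\<sigma>' n" "\<tau> n"] triangle[of "\<sigma>' n" "\<tau>' n" "\<tau> n"] M commute[of "\<tau> n" "\<tau>' n"]
      by auto
    moreover have "d (\<sigma>' n) (\<tau>' n) \<le> d (\<sigma> n) (\<sigma>' n) + (d (\<sigma> n) (\<tau> n) + d (\<tau> n) (\<tau>' n))"
      using triangle[of "\<sigma>' n" "\<sigma> n" "\<tau>' n"] triangle[of "\<sigma> n" "\<tau> n" "\<tau>' n"] M commute[of "\<sigma> n" "\<sigma>' n"]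
      by auto
    ultimately show ?thesis by linarith
  qed
  then have "(\<lambda>n. d (\<sigma> n) (\<tau> n) - d (\<sigma>' n) (\<tau>' n)) \<longlonglongrightarrow> 0"
    by (intro Lim_null_comparison[OF _ z]) simp
  from tendsto_add[OF this lim'] show ?thesis by simp
qed

lemma completion_nonempty:
  assumes "A \<in> completion"
  obtains \<sigma> where "\<sigma> \<in> A" "MCauchy \<sigma>"
  using assms equiv_class_self[OF equiv_Cauchy_rel]
  unfolding completion_def quotient_def by auto

lemma Metric_space_completion: "Metric_space completion completion_dist"
proof
  fix A B
  show "completion_dist A B = completion_dist B A"
    by (simp add: completion_dist_def commute)
  show "0 \<le> completion_dist A B"
  proof (cases "A \<in> completion \<and> B \<in> completion")
    case True
    then obtain \<sigma> \<tau> where "\<sigma> \<in> A" "\<tau> \<in> B"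
      by (meson completion_nonempty)
    then show ?thesis
      using LIMSEQ_le_const[OF completion_dist_lim] True nonneg by blast
  qed (auto simp: completion_dist_def)
next
  fix A B assume AB: "A \<in> completion" "B \<in> completion"
  then obtain \<sigma> \<tau> where *: "\<sigma> \<in> A" "MCauchy \<sigma>" "\<tau> \<in> B" "MCauchy \<tau>"
    by (meson completion_nonempty)
  have lim: "(\<lambda>n. d (\<sigma> n) (\<tau> n)) \<longlonglongrightarrow> completion_dist A B"
    using completion_dist_lim AB * by blast
  have "completion_dist A B = 0 \<longleftrightarrow> (\<lambda>n. d (\<sigma> n) (\<tau> n)) \<longlonglongrightarrow> 0"
    using lim LIMSEQ_unique by auto
  also have "\<dots> \<longleftrightarrow> (\<sigma>, \<tau>) \<in> Cauchy_rel"
    using * by (simp add: Cauchy_rel_def)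
  also have "\<dots> \<longleftrightarrow> A = B"
    using quotient_eq_iff[OF equiv_Cauchy_rel] AB * unfolding completion_def by blast
  finally show "completion_dist A B = 0 \<longleftrightarrow> A = B" .
next
  fix A B C assume ABC: "A \<in> completion" "B \<in> completion" "C \<in> completion"
  then obtain \<sigma> \<tau> \<upsilon> where *: "\<sigma> \<in> A" "MCauchy \<sigma>" "\<tau> \<in> B" "MCauchy \<tau>" "\<upsilon> \<in> C" "MCauchy \<upsilon>"
    by (meson completion_nonempty)
  have "(\<lambda>n. d (\<sigma> n) (\<tau> n) + d (\<tau> n) (\<upsilon> n)) \<longlonglongrightarrow> completion_dist A B + completion_dist B C"
    by (intro tendsto_add completion_dist_lim ABC *)
  moreover have "d (\<sigma> n) (\<upsilon> n) \<le> d (\<sigma> n) (\<tau> n) + d (\<tau> n) (\<upsilon> n)" for n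
    using * by (intro triangle) (auto simp: MCauchy_def)
  ultimately show "completion_dist A C \<le> completion_dist A B + completion_dist B C"
    using LIMSEQ_le[OF completion_dist_lim] ABC * by blast
qed

lemma completion_embed_in: "x \<in> M \<Longrightarrow> completion_embed x \<in> completion"
  unfolding completion_embed_def completion_def
  by (rule quotientI) (simp add: MCauchy_def image_subset_iff)

lemma completion_dist_embed:
  assumes "x \<in> M" "y \<in> M"
  shows "completion_dist (completion_embed x) (completion_embed y) = d x y"
proof -
  have "(\<lambda>_. z) \<in> completion_embed z" if "z \<in> M" for z
    using that by (auto simp: completion_embed_def Cauchy_rel_def MCauchy_def)
  then have "(\<lambda>_. d x y) \<longlonglongrightarrow> completion_dist (completion_embed x) (completion_embed y)"
    using completion_dist_lim[OF completion_embed_in completion_embed_in] assms by blast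
  then show ?thesis
    using LIMSEQ_unique tendsto_const by blast
qed

end


section \<open>Uniform spaces\<close>

context Metric_space
begin

text \<open>Products are formed in \<^typ>\<open>ennreal\<close>, so that the distance to an empty boundary is infinite.\<close>

definition uniform_curve :: "real \<Rightarrow> real \<Rightarrow> real \<Rightarrow> (real \<Rightarrow> (nat \<Rightarrow> 'a) set) \<Rightarrow> bool" where
  "uniform_curve C s u \<gamma> \<longleftrightarrow>
     Metric_space.curve completion completion_dist s u \<gamma> \<and>
     Metric_space.curve_length completion_dist s u \<gamma>
       \<le> ennreal C * ennreal (completion_dist (\<gamma> s) (\<gamma> u)) \<and>
     (\<forall>t \<in> {s..u}.
        min (Metric_space.curve_length completion_dist s t \<gamma>)
            (Metric_space.curve_length completion_dist t u \<gamma>)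
          \<le> ennreal C * (INF w \<in> metric_boundary. ennreal (completion_dist (\<gamma> t) w)))"

definition C_uniform :: "real \<Rightarrow> bool" where
  "C_uniform C \<longleftrightarrow> C \<ge> 1 \<and> locally_compact_space mtopology \<and> \<not> mcomplete \<and>
     (\<forall>x \<in> M. \<forall>y \<in> M. \<exists>s u \<gamma>. curve s u \<gamma> \<and> \<gamma> s = x \<and> \<gamma> u = y \<and>
        uniform_curve C s u (completion_embed \<circ> \<gamma>))"

definition uniform :: bool where
  "uniform \<longleftrightarrow> (\<exists>C. C_uniform C)"

end


section \<open>The upper half-plane and densities\<close>

text \<open>The distance of the product type \<^typ>\<open>real \<times> real\<close> is the Euclidean one.\<close>

definition upper_half_plane :: "(real \<times> real) set" where
  "upper_half_plane = UNIV \<times> {0<..}"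

definition quasidecreasing :: "(real \<Rightarrow> real) \<Rightarrow> bool" where
  "quasidecreasing \<rho> \<longleftrightarrow> (\<exists>C\<ge>1. \<forall>s t. 0 < s \<and> s \<le> t \<longrightarrow> \<rho> t \<le> C * \<rho> s)"

end

theory Submission
  imports Defs
begin

text \<open>
The Euclidean half-plane is \<open>pi / 2\<close>-uniform because hyperbolic geodesics, that is, circular arcs centered
on the boundary line and vertical segments, are \<open>pi / 2\<close>-uniform curves. On an arc of radius \<open>R\<close> and
opening angle \<open>\<delta>\<close> the length is \<open>R * \<delta>\<close>, the chord is \<open>2 * R * sin (\<delta> / 2)\<close> and the height of the point with angle
\<open>\<theta>\<close> is \<open>R * sin \<theta>\<close>, so both conditions come down to \<open>x \<le> pi / 2 * sin x\<close> on \<open>{0..pi / 2}\<close>.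

For the failure of uniformity after sphericalization let \<open>F r\<close> be the integral of \<open>\<rho>\<close> over \<open>{r<..}\<close>, and
let \<open>C\<close> be the constant for which \<open>\<rho>\<close> is quasidecreasing. Two estimates control \<open>d\<^sub>\<rho>\<close>.

  \<^item> \<open>d\<^sub>\<rho> x y \<le> F (norm x) + F (norm y)\<close> (\<open>d_le_tails\<close>): run radially from both points to a circle of
    large radius \<open>R\<close>; joining the end points along the circle costs at most \<open>pi * R * \<rho> R\<close>, which tends to \<open>0\<close>.

  \<^item> \<open>F (norm x) - F (norm x + dist x y) \<le> C * d\<^sub>\<rho> x y\<close> (\<open>d_ge\<close>): after arc length \<open>r\<close> a curve that starts
    in \<open>x\<close> is at distance at most \<open>norm x + r\<close> from the origin, so the weight there is at least
    \<open>\<rho> (norm x + r) / C\<close>.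

By the first estimate the completion has a boundary point at infinity whose distance to \<open>z\<close> is at most
\<open>F (norm z)\<close>. The hypothesis on the infimum yields a radius \<open>R\<close> with \<open>F R\<close> far below \<open>R * \<rho> R\<close>. Then
\<open>F\<close> rises so steeply to the left of \<open>R\<close> that \<open>F r = Q * F R\<close> for some \<open>r \<ge> R / 2\<close>, where \<open>Q\<close> is any
prescribed constant (\<open>radii_exist\<close>). Take \<open>x\<close> and \<open>y\<close> of norm \<open>r\<close> and Euclidean distance comparable to \<open>R\<close>,
and a uniform curve between them. If it leaves the disc of radius \<open>R\<close>, then at a point outside the disc
both \<open>d\<^sub>\<rho>\<close>-distances to \<open>x\<close> and \<open>y\<close> are at least \<open>(Q - 1) * F R / C\<close> but infinity is at distance at most
\<open>F R\<close>, which violates condition (ii) for large \<open>Q\<close>. If it stays in the disc, where \<open>\<rho>\<close> is at least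
\<open>\<rho> R / C\<close>, its \<open>d\<^sub>\<rho>\<close>-length is at least comparable to \<open>R * \<rho> R\<close> (\<open>sphericalized_length_ge\<close>), whereas
\<open>d\<^sub>\<rho> x y \<le> 2 * Q * F R\<close> is far smaller, which violates condition (i).

That \<open>d\<^sub>\<rho>\<close> is a metric at all rests on arc length: the length of a rectifiable curve is additive and depends
continuously on the end point, so the arc length parametrization runs through the whole curve and is
1-Lipschitz, and line integrals behave as expected under reversal and concatenation.
\<close>

section \<open>Arc length in metric spaces\<close>

context Metric_space
begin

lemma sum_le_curve_length:
  assumes "t 0 = s" "t n = u" "mono_on {..n} t"
  shows "(\<Sum>i<n. ennreal (d (\<gamma> (t i)) (\<gamma> (t (Suc i))))) \<le> curve_length s u \<gamma>"
  unfolding curve_length_def by (rule SUP_upper2[of "(n, t)"]) (use assms in auto)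

lemma curve_length_leI:
  assumes "\<And>n t. t 0 = s \<Longrightarrow> t n = u \<Longrightarrow> mono_on {..n} t \<Longrightarrow>
    (\<Sum>i<n. ennreal (d (\<gamma> (t i)) (\<gamma> (t (Suc i))))) \<le> B"
  shows "curve_length s u \<gamma> \<le> B"
  unfolding curve_length_def by (rule SUP_least) (use assms in auto)

lemma partition_bounds:
  fixes t :: "nat \<Rightarrow> real"
  assumes "t 0 = s" "t n = u" "mono_on {..n} t" "i \<le> n"
  shows "t i \<in> {s..u}"
  using assms mono_onD[OF assms(3), of 0 i] mono_onD[OF assms(3), of i n] by auto

lemma dist_le_curve_length:
  assumes "s \<le> u"
  shows "ennreal (d (\<gamma> s) (\<gamma> u)) \<le> curve_length s u \<gamma>"
  using sum_le_curve_length[of "\<lambda>i. if i = 0 then s else u" s 1 u \<gamma>] assms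
  by (auto simp: mono_on_def)

lemma curve_length_cong_le:
  assumes "\<And>r. r \<in> {s..u} \<Longrightarrow> \<gamma> r = \<gamma>' r"
  shows "curve_length s u \<gamma> \<le> curve_length s u \<gamma>'"
proof (rule curve_length_leI)
  fix n and t :: "nat \<Rightarrow> real" assume t: "t 0 = s" "t n = u" "mono_on {..n} t"
  have "(\<Sum>i<n. ennreal (d (\<gamma> (t i)) (\<gamma> (t (Suc i))))) = (\<Sum>i<n. ennreal (d (\<gamma>' (t i)) (\<gamma>' (t (Suc i)))))"
  proof (intro sum.cong refl)
    fix i assume "i \<in> {..<n}"
    then have "t i \<in> {s..u}" "t (Suc i) \<in> {s..u}" using partition_bounds[OF t] by auto
    then show "ennreal (d (\<gamma> (t i)) (\<gamma> (t (Suc i)))) = ennreal (d (\<gamma>' (t i)) (\<gamma>' (t (Suc i))))"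
      by (simp add: assms)
  qed
  then show "(\<Sum>i<n. ennreal (d (\<gamma> (t i)) (\<gamma> (t (Suc i))))) \<le> curve_length s u \<gamma>'"
    using sum_le_curve_length[OF t] by simp
qed

lemma curve_length_cong:
  assumes "\<And>r. r \<in> {s..u} \<Longrightarrow> \<gamma> r = \<gamma>' r"
  shows "curve_length s u \<gamma> = curve_length s u \<gamma>'"
  by (rule antisym; rule curve_length_cong_le) (use assms in auto)

lemma curve_length_shift: "curve_length (s + c) (u + c) (\<lambda>r. \<gamma> (r - c)) = curve_length s u \<gamma>"
proof -
  have *: "curve_length (s + c) (u + c) (\<lambda>r. \<gamma> (r - c)) \<le> curve_length s u \<gamma>" for s u c \<gamma>
  proof (rule curve_length_leI)
    fix n and t :: "nat \<Rightarrow> real" assume "t 0 = s + c" "t n = u + c" "mono_on {..n} t"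
    then show "(\<Sum>i<n. ennreal (d (\<gamma> (t i - c)) (\<gamma> (t (Suc i) - c)))) \<le> curve_length s u \<gamma>"
      by (intro sum_le_curve_length[of "\<lambda>i. t i - c"]) (auto simp: mono_on_def)
  qed
  show ?thesis
    using *[of s c u \<gamma>] *[of "s + c" "- c" "u + c" "\<lambda>r. \<gamma> (r - c)"] by simp
qed

lemma curve_length_reverse: "curve_length (- u) (- s) (\<lambda>r. \<gamma> (- r)) = curve_length s u \<gamma>"
proof -
  have *: "curve_length (- u) (- s) (\<lambda>r. \<gamma> (- r)) \<le> curve_length s u \<gamma>" for s u \<gamma>
  proof (rule curve_length_leI)
    fix n and t :: "nat \<Rightarrow> real" assume t: "t 0 = - u" "t n = - s" "mono_on {..n} t"
    have "(\<Sum>i<n. ennreal (d (\<gamma> (- t i)) (\<gamma> (- t (Suc i)))))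
        = (\<Sum>i<n. ennreal (d (\<gamma> (- t (n - Suc i))) (\<gamma> (- t (Suc (n - Suc i))))))"
      by (rule sum.nat_diff_reindex[symmetric])
    also have "\<dots> = (\<Sum>i<n. ennreal (d (\<gamma> (- t (n - i))) (\<gamma> (- t (n - Suc i)))))"
      by (intro sum.cong) (auto simp: commute Suc_diff_Suc)
    also have "\<dots> \<le> curve_length s u \<gamma>"
      by (rule sum_le_curve_length[of "\<lambda>i. - t (n - i)"])
         (use t in \<open>auto simp: mono_on_def\<close>)
    finally show "(\<Sum>i<n. ennreal (d (\<gamma> (- t i)) (\<gamma> (- t (Suc i))))) \<le> curve_length s u \<gamma>" .
  qed
  show ?thesis
    using *[of u s \<gamma>] *[of "-s" "-u" "\<lambda>r. \<gamma> (- r)"] by simp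
qed

text \<open>For a Lipschitz curve the bounds for the partition sums telescope.\<close>

lemma curve_length_Lipschitz_le:
  assumes lip: "\<And>r r'. s \<le> r \<Longrightarrow> r \<le> r' \<Longrightarrow> r' \<le> u \<Longrightarrow> d (\<gamma> r) (\<gamma> r') \<le> K * (r' - r)"
  shows "curve_length s u \<gamma> \<le> ennreal (K * (u - s))"
proof (rule curve_length_leI)
  fix n and t :: "nat \<Rightarrow> real" assume t: "t 0 = s" "t n = u" "mono_on {..n} t"
  have "(\<Sum>i<n. ennreal (d (\<gamma> (t i)) (\<gamma> (t (Suc i))))) = ennreal (\<Sum>i<n. d (\<gamma> (t i)) (\<gamma> (t (Suc i))))"
    by (simp add: sum_ennreal)
  also have "\<dots> \<le> ennreal (\<Sum>i<n. K * t (Suc i) - K * t i)"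
  proof (intro ennreal_leI sum_mono)
    fix i assume i: "i \<in> {..<n}"
    then have "t i \<le> t (Suc i)" using mono_onD[OF t(3), of i "Suc i"] by auto
    then show "d (\<gamma> (t i)) (\<gamma> (t (Suc i))) \<le> K * t (Suc i) - K * t i"
      using lip[of "t i" "t (Suc i)"] partition_bounds[OF t] i by (auto simp: algebra_simps)
  qed
  also have "\<dots> = ennreal (K * (u - s))"
    by (subst sum_lessThan_telescope) (simp add: t algebra_simps)
  finally show "(\<Sum>i<n. ennreal (d (\<gamma> (t i)) (\<gamma> (t (Suc i))))) \<le> ennreal (K * (u - s))" .
qed

lemma curve_iff:
  "curve s u \<gamma> \<longleftrightarrow> s \<le> u \<and> \<gamma> ` {s..u} \<subseteq> M \<and>
     (\<forall>t\<in>{s..u}. \<forall>e>0. \<exists>\<delta>>0. \<forall>t'\<in>{s..u}. \<bar>t' - t\<bar> < \<delta> \<longrightarrow> d (\<gamma> t) (\<gamma> t') < e)"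
  (is "_ \<longleftrightarrow> _ \<and> _ \<and> ?R")
proof (cases "s \<le> u \<and> \<gamma> ` {s..u} \<subseteq> M")
  case True
  have "continuous_map (top_of_set {s..u}) mtopology \<gamma> \<longleftrightarrow> ?R"
    unfolding continuous_map_to_metric
  proof (intro iffI ballI allI impI)
    fix t e assume *: "\<forall>x\<in>topspace (top_of_set {s..u}). \<forall>\<epsilon>>0. \<exists>U. openin (top_of_set {s..u}) U \<and> x \<in> U \<and> (\<forall>y\<in>U. \<gamma> y \<in> mball (\<gamma> x) \<epsilon>)"
      and t: "t \<in> {s..u}" and e: "(0::real) < e"
    have "\<exists>U. openin (top_of_set {s..u}) U \<and> t \<in> U \<and> (\<forall>y\<in>U. \<gamma> y \<in> mball (\<gamma> t) e)"
      using * t e unfolding topspace_euclidean_subtopology by blast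
    then obtain U where U: "openin (top_of_set {s..u}) U" "t \<in> U" "\<forall>y\<in>U. \<gamma> y \<in> mball (\<gamma> t) e"
      by blast
    then have "\<exists>\<delta>>0. \<forall>x'\<in>{s..u}. dist x' t < \<delta> \<longrightarrow> x' \<in> U"
      unfolding openin_euclidean_subtopology_iff by blast
    then obtain \<delta> where "\<delta> > 0" "\<forall>x'\<in>{s..u}. dist x' t < \<delta> \<longrightarrow> x' \<in> U" by blast
    then show "\<exists>\<delta>>0. \<forall>t'\<in>{s..u}. \<bar>t' - t\<bar> < \<delta> \<longrightarrow> d (\<gamma> t) (\<gamma> t') < e"
      using U by (intro exI[of _ \<delta>]) (auto simp: dist_real_def)
  next
    fix t e assume R: ?R and t: "t \<in> topspace (top_of_set {s..u})" and e: "(0::real) < e"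
    then obtain \<delta> where \<delta>: "\<delta> > 0" "\<forall>t'\<in>{s..u}. \<bar>t' - t\<bar> < \<delta> \<longrightarrow> d (\<gamma> t) (\<gamma> t') < e"
      unfolding topspace_euclidean_subtopology by blast
    have "openin (top_of_set {s..u}) ({s..u} \<inter> ball t \<delta>)" by auto
    then show "\<exists>U. openin (top_of_set {s..u}) U \<and> t \<in> U \<and> (\<forall>y\<in>U. \<gamma> y \<in> mball (\<gamma> t) e)"
      using \<delta> t True by (intro exI[of _ "{s..u} \<inter> ball t \<delta>"]) (auto simp: dist_real_def abs_minus_commute)
  qed
  then show ?thesis using True by (simp add: curve_def)
next
  case False
  have "curve s u \<gamma> \<Longrightarrow> \<gamma> ` {s..u} \<subseteq> M" 
    unfolding curve_def using continuous_map_image_subset_topspace by fastforce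
  then show ?thesis using False unfolding curve_def by blast
qed

lemma curve_in_M: "curve s u \<gamma> \<Longrightarrow> r \<in> {s..u} \<Longrightarrow> \<gamma> r \<in> M"
  by (auto simp: curve_iff)

lemma curve_reverse:
  assumes "curve s u \<gamma>" shows "curve (- u) (- s) (\<lambda>r. \<gamma> (- r))"
proof -
  have "continuous_on {- u.. - s} (\<lambda>r. - r)" by (intro continuous_intros)
  then have "continuous_map (top_of_set {- u.. - s}) (top_of_set {s..u}) (\<lambda>r. - r)"
    by (auto simp: continuous_map_in_subtopology)
  then have "continuous_map (top_of_set {- u.. - s}) mtopology (\<gamma> \<circ> (\<lambda>r. - r))"
    using assms unfolding curve_def by (intro continuous_map_compose) auto
  then show ?thesis using assms by (auto simp: curve_def o_def)
qed

lemma Lipschitz_curve: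
  assumes "s \<le> u" "\<gamma> ` {s..u} \<subseteq> M"
    and lip: "\<And>r r'. s \<le> r \<Longrightarrow> r \<le> r' \<Longrightarrow> r' \<le> u \<Longrightarrow> d (\<gamma> r) (\<gamma> r') \<le> K * (r' - r)"
  shows "curve s u \<gamma>" "rectifiable s u \<gamma>"
proof -
  show "rectifiable s u \<gamma>"
    using curve_length_Lipschitz_le[of s u \<gamma> K] lip
    by (auto simp: rectifiable_def less_top[symmetric] top_unique)
  have l: "d (\<gamma> r) (\<gamma> r') \<le> \<bar>K\<bar> * \<bar>r' - r\<bar>" if "r \<in> {s..u}" "r' \<in> {s..u}" for r r'
  proof -
    have 1: "d (\<gamma> a) (\<gamma> b) \<le> \<bar>K\<bar> * \<bar>b - a\<bar>" if "s \<le> a" "a \<le> b" "b \<le> u" for a b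
    proof -
      have "K * (b - a) \<le> \<bar>K\<bar> * (b - a)" using that by (intro mult_right_mono) auto
      then show ?thesis using lip[OF that] that by simp
    qed
    show ?thesis using 1[of r r'] 1[of r' r] that
      by (cases "r \<le> r'") (auto simp: commute abs_minus_commute)
  qed
  show "curve s u \<gamma>" unfolding curve_iff
  proof (intro conjI ballI allI impI assms(1,2))
    fix t e assume t: "t \<in> {s..u}" and e: "(0::real) < e"
    have "d (\<gamma> t) (\<gamma> t') < e" if "t' \<in> {s..u}" "\<bar>t' - t\<bar> < e / (\<bar>K\<bar> + 1)" for t'
    proof -
      have "\<bar>K\<bar> * \<bar>t' - t\<bar> \<le> (\<bar>K\<bar> + 1) * \<bar>t' - t\<bar>" by (intro mult_right_mono) auto
      also have "\<dots> < e" using that by (simp add: pos_less_divide_eq mult.commute)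
      finally show ?thesis using l[OF t that(1)] by simp
    qed
    then show "\<exists>\<delta>>0. \<forall>t'\<in>{s..u}. \<bar>t' - t\<bar> < \<delta> \<longrightarrow> d (\<gamma> t) (\<gamma> t') < e"
      using e by (intro exI[of _ "e / (\<bar>K\<bar> + 1)"]) auto
  qed
qed

text \<open>Truncating the partition points at \<open>c\<close> from above and from below splits a partition sum without
choosing an index at which \<open>c\<close> has to be inserted: a step on one side of \<open>c\<close> contributes to one sum
only, and the step across \<open>c\<close> is divided by the triangle inequality.\<close>

lemma partition_sum_split:
  fixes t :: "nat \<Rightarrow> real"
  assumes M: "\<And>i. i \<le> n \<Longrightarrow> \<gamma> (t i) \<in> M" "\<gamma> c \<in> M" and mono: "mono_on {..n} t"
  shows "(\<Sum>i<n. ennreal (d (\<gamma> (t i)) (\<gamma> (t (Suc i)))))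
    \<le> (\<Sum>i<n. ennreal (d (\<gamma> (min (t i) c)) (\<gamma> (min (t (Suc i)) c))))
      + (\<Sum>i<n. ennreal (d (\<gamma> (max (t i) c)) (\<gamma> (max (t (Suc i)) c))))"
proof -
  have "d (\<gamma> (t i)) (\<gamma> (t (Suc i)))
      \<le> d (\<gamma> (min (t i) c)) (\<gamma> (min (t (Suc i)) c)) + d (\<gamma> (max (t i) c)) (\<gamma> (max (t (Suc i)) c))"
    if "i < n" for i
  proof -
    have "t i \<le> t (Suc i)" using mono_onD[OF mono, of i "Suc i"] that by auto
    then show ?thesis
      using triangle[of "\<gamma> (t i)" "\<gamma> c" "\<gamma> (t (Suc i))"] M that nonneg
      by (auto simp: min_def max_def)
  qed
  then show ?thesis
    by (auto simp: sum.distrib[symmetric] ennreal_plus[symmetric] simp del: ennreal_plus sum_ennreal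
      intro!: sum_mono ennreal_leI)
qed

lemma mono_on_clamp:
  fixes t :: "nat \<Rightarrow> real"
  assumes "mono_on {..n} t"
  shows "mono_on {..n} (\<lambda>i. min (t i) c)" "mono_on {..n} (\<lambda>i. max (t i) c)"
  by (auto intro!: mono_onI min.mono max.mono mono_onD[OF assms])

text \<open>Truncated partitions give one inequality, concatenated partitions the other.\<close>

lemma curve_length_additive:
  assumes "s \<le> c" "c \<le> u" "\<gamma> ` {s..u} \<subseteq> M"
  shows "curve_length s u \<gamma> = curve_length s c \<gamma> + curve_length c u \<gamma>"
proof (rule antisym)
  show "curve_length s u \<gamma> \<le> curve_length s c \<gamma> + curve_length c u \<gamma>"
  proof (rule curve_length_leI)
    fix n and t :: "nat \<Rightarrow> real" assume t: "t 0 = s" "t n = u" "mono_on {..n} t"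
    have "\<gamma> (t i) \<in> M" if "i \<le> n" for i using assms(3) partition_bounds[OF t that] by auto
    then have "(\<Sum>i<n. ennreal (d (\<gamma> (t i)) (\<gamma> (t (Suc i)))))
      \<le> (\<Sum>i<n. ennreal (d (\<gamma> (min (t i) c)) (\<gamma> (min (t (Suc i)) c))))
      + (\<Sum>i<n. ennreal (d (\<gamma> (max (t i) c)) (\<gamma> (max (t (Suc i)) c))))"
      using assms by (intro partition_sum_split t) auto
    also have "\<dots> \<le> curve_length s c \<gamma> + curve_length c u \<gamma>"
      using t assms by (intro add_mono sum_le_curve_length mono_on_clamp) auto
    finally show "(\<Sum>i<n. ennreal (d (\<gamma> (t i)) (\<gamma> (t (Suc i))))) \<le> \<dots>" .
  qed
next
  define P where "P s u = {(n :: nat, t :: nat \<Rightarrow> real). t 0 = s \<and> t n = u \<and> mono_on {..n} t}" for s u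
  define S where "S = (\<lambda>(n, t). \<Sum>i<n. ennreal (d (\<gamma> (t i)) (\<gamma> (t (Suc i)))))"
  have cl: "curve_length s u \<gamma> = (SUP p\<in>P s u. S p)" for s u
    unfolding curve_length_def P_def S_def by (simp add: case_prod_unfold)
  have ne: "P s u \<noteq> {}" if "s \<le> u" for s u
  proof -
    have "(1, \<lambda>i. if i = 0 then s else u) \<in> P s u" using that by (auto simp: P_def mono_on_def)
    then show ?thesis by blast
  qed
  have glue: "S p + S q \<le> curve_length s u \<gamma>" if p: "p \<in> P s c" and q: "q \<in> P c u" for p q
  proof -
    obtain n t where p': "p = (n, t)" "t 0 = s" "t n = c" "mono_on {..n} t" using p by (auto simp: P_def)
    obtain m r where q': "q = (m, r)" "r 0 = c" "r m = u" "mono_on {..m} r" using q by (auto simp: P_def)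
    \<comment> \<open>The two partitions agree at index \<open>n\<close>, as \<open>t n = c = r 0\<close>.\<close>
    define w where "w i = (if i \<le> n then t i else r (i - n))" for i
    have w2: "w (n + j) = r j" for j using p' q' by (cases "j = 0") (auto simp: w_def)
    have mono: "mono_on {..n+m} w"
    proof (rule mono_onI)
      fix i j assume ij: "i \<in> {..n+m}" "j \<in> {..n+m}" "i \<le> j"
      have ti: "t i \<le> c" if "i \<le> n" using mono_onD[OF p'(4), of i n] that p' by auto
      have rj: "c \<le> r (j - n)" if "\<not> j \<le> n" using mono_onD[OF q'(4), of 0 "j - n"] that q' ij by auto
      show "w i \<le> w j"
        using ti rj mono_onD[OF p'(4), of i j] mono_onD[OF q'(4), of "i - n" "j - n"] ij
        unfolding w_def by (cases "i \<le> n"; cases "j \<le> n") auto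
    qed
    have "S p + S q = (\<Sum>i<n. ennreal (d (\<gamma> (w i)) (\<gamma> (w (Suc i)))))
        + (\<Sum>i<m. ennreal (d (\<gamma> (w (n + i))) (\<gamma> (w (n + Suc i)))))"
      unfolding S_def p'(1) q'(1) w2 by (auto simp: w_def intro!: sum.cong)
    also have "\<dots> = (\<Sum>i<n + m. ennreal (d (\<gamma> (w i)) (\<gamma> (w (Suc i)))))"
      by (induction m) (auto simp: add.assoc[symmetric])
    also have "\<dots> \<le> curve_length s u \<gamma>"
      using p' q' w2[of m] by (intro sum_le_curve_length mono) (auto simp: w_def)
    finally show ?thesis .
  qed
  have "S p + curve_length c u \<gamma> \<le> curve_length s u \<gamma>" if "p \<in> P s c" for p
    unfolding cl[of c] ennreal_SUP_add_right[OF ne[OF assms(2)]]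
    by (rule SUP_least) (use glue that in auto)
  then show "curve_length s c \<gamma> + curve_length c u \<gamma> \<le> curve_length s u \<gamma>"
    unfolding cl[of s c] ennreal_SUP_add_left[OF ne[OF assms(1)], symmetric]
    by (intro SUP_least) auto
qed

lemma curve_length_mono:
  assumes "s \<le> s'" "s' \<le> u'" "u' \<le> u" "\<gamma> ` {s..u} \<subseteq> M"
  shows "curve_length s' u' \<gamma> \<le> curve_length s u \<gamma>"
proof -
  have 1: "curve_length s u \<gamma> = curve_length s s' \<gamma> + curve_length s' u \<gamma>"
    using assms by (intro curve_length_additive) auto
  have 2: "curve_length s' u \<gamma> = curve_length s' u' \<gamma> + curve_length u' u \<gamma>"
    using assms by (intro curve_length_additive image_subset_iff[THEN iffD2]) auto
  show ?thesis unfolding 1 2 by (metis add.commute add_increasing2 le_iff_add zero_le)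
qed

text \<open>Continuity of arc length at \<open>t0\<close>, in a form without differences of extended reals. A partition whose
sum almost attains the length of the whole curve is truncated to the pieces before \<open>a\<close>, between \<open>a\<close>
and \<open>b\<close>, and after \<open>b\<close>. Each of the \<open>n\<close> terms of the middle piece is small because the curve is
continuous at \<open>t0\<close>, so the arc length that lies between \<open>a\<close> and \<open>b\<close> is small as well.\<close>

lemma curve_length_small:
  assumes \<gamma>: "curve s u \<gamma>" "rectifiable s u \<gamma>" and t0: "t0 \<in> {s..u}" and e: "e > 0"
  shows "\<exists>\<delta>>0. \<forall>a b. s \<le> a \<longrightarrow> a \<le> b \<longrightarrow> b \<le> u \<longrightarrow> \<bar>a - t0\<bar> < \<delta> \<longrightarrow> \<bar>b - t0\<bar> < \<delta> \<longrightarrow>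
    curve_length a b \<gamma> \<le> ennreal e"
proof -
  have im: "\<gamma> ` {s..u} \<subseteq> M" using \<gamma> by (simp add: curve_iff)
  define L where "L = curve_length s u \<gamma>"
  have Lfin: "L < \<infinity>" using \<gamma> by (simp add: L_def rectifiable_def)
  have "\<exists>n t. t 0 = s \<and> t n = u \<and> mono_on {..n} t \<and>
     L \<le> (\<Sum>i<n. ennreal (d (\<gamma> (t i)) (\<gamma> (t (Suc i))))) + ennreal (e / 2)"
  proof (rule ccontr)
    assume *: "\<not> ?thesis"
    have "L \<le> L - ennreal (e/2)" unfolding L_def
    proof (rule curve_length_leI, fold L_def)
      fix n and t :: "nat \<Rightarrow> real" assume t: "t 0 = s" "t n = u" "mono_on {..n} t"
      then have "(\<Sum>i<n. ennreal (d (\<gamma> (t i)) (\<gamma> (t (Suc i))))) + ennreal (e / 2) \<le> L"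
        using * by (meson nle_le)
      then show "(\<Sum>i<n. ennreal (d (\<gamma> (t i)) (\<gamma> (t (Suc i))))) \<le> L - ennreal (e / 2)"
        by (simp add: ennreal_le_minus_iff add.commute)
    qed
    moreover have "L \<noteq> 0"
    proof
      assume "L = 0"
      with *[unfolded not_ex, rule_format, of "\<lambda>i. if i = 0 then s else u" 1] have "\<not> (s \<le> u)"
        by (auto simp: mono_on_def split: if_splits)
      with t0 show False by auto
    qed
    moreover obtain l where "L = ennreal l" "0 \<le> l"
      using Lfin by (cases L) auto
    ultimately show False
      using e by (auto simp: ennreal_minus ennreal_le_iff2)
  qed
  then obtain n t where t: "t 0 = s" "t n = u" "mono_on {..n} t"
    and near: "L \<le> (\<Sum>i<n. ennreal (d (\<gamma> (t i)) (\<gamma> (t (Suc i))))) + ennreal (e / 2)" by blast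
  \<comment> \<open>The \<open>n\<close> middle terms are at most \<open>2 * \<eta>\<close> each and have to add up to at most \<open>e / 2\<close>.\<close>
  define \<eta> where "\<eta> = e / (4 * (real n + 1))"
  have \<eta>: "\<eta> > 0" using e by (simp add: \<eta>_def)
  obtain \<delta> where \<delta>: "\<delta> > 0" "\<forall>t'\<in>{s..u}. \<bar>t' - t0\<bar> < \<delta> \<longrightarrow> d (\<gamma> t0) (\<gamma> t') < \<eta>"
    using \<gamma>(1) t0 \<eta> unfolding curve_iff by blast
  have "curve_length a b \<gamma> \<le> ennreal e"
    if ab: "s \<le> a" "a \<le> b" "b \<le> u" "\<bar>a - t0\<bar> < \<delta>" "\<bar>b - t0\<bar> < \<delta>" for a b
  proof -
    let ?S = "\<lambda>t. \<Sum>i<n. ennreal (d (\<gamma> (t i)) (\<gamma> (t (Suc i))))"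
    have M: "\<gamma> r \<in> M" if "r \<in> {s..u}" for r using im that by auto
    have osc: "d (\<gamma> r) (\<gamma> r') \<le> 2 * \<eta>" if "r \<in> {a..b}" "r' \<in> {a..b}" for r r'
    proof -
      have "r \<in> {s..u}" "r' \<in> {s..u}" "\<bar>r - t0\<bar> < \<delta>" "\<bar>r' - t0\<bar> < \<delta>" using that ab by auto
      then show ?thesis
        using \<delta>(2)[rule_format, of r] \<delta>(2)[rule_format, of r'] M t0
          triangle[of "\<gamma> r" "\<gamma> t0" "\<gamma> r'"] commute[of "\<gamma> r" "\<gamma> t0"] by auto
    qed
    have tb: "t i \<in> {s..u}" if "i \<le> n" for i using partition_bounds[OF t that] .
    have "?S t \<le> ?S (\<lambda>i. min (t i) a) + ?S (\<lambda>i. max (t i) a)"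
      using ab tb t0 by (intro partition_sum_split M t) auto
    also have "?S (\<lambda>i. max (t i) a) \<le> ?S (\<lambda>i. min (max (t i) a) b) + ?S (\<lambda>i. max (max (t i) a) b)"
      using ab tb t0 by (intro partition_sum_split M mono_on_clamp t) (auto simp: max_def)
    also have "?S (\<lambda>i. min (t i) a) \<le> curve_length s a \<gamma>"
      using ab t by (intro sum_le_curve_length mono_on_clamp) auto
    also have "?S (\<lambda>i. max (max (t i) a) b) \<le> curve_length b u \<gamma>"
      using ab t by (intro sum_le_curve_length mono_on_clamp) auto
    also have "?S (\<lambda>i. min (max (t i) a) b) \<le> (\<Sum>i<n. ennreal (2 * \<eta>))"
      using ab by (intro sum_mono ennreal_leI osc) auto
    also have "(\<Sum>i<n. ennreal (2 * \<eta>)) = ennreal (real n * (2 * \<eta>))"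
      using \<eta> by (simp add: ennreal_mult ennreal_of_nat_eq_real_of_nat)
    also have "\<dots> \<le> ennreal (e / 2)"
      using e by (intro ennreal_leI) (simp add: \<eta>_def field_simps)
    finally have S: "?S t \<le> curve_length s a \<gamma> + (ennreal (e / 2) + curve_length b u \<gamma>)"
      by (simp add: add_mono)
    have add: "L = curve_length s a \<gamma> + (curve_length a b \<gamma> + curve_length b u \<gamma>)"
    proof -
      have "curve_length a u \<gamma> = curve_length a b \<gamma> + curve_length b u \<gamma>"
        by (intro curve_length_additive) (use ab M in auto)
      moreover have "L = curve_length s a \<gamma> + curve_length a u \<gamma>"
        unfolding L_def by (intro curve_length_additive) (use ab M in auto)
      ultimately show ?thesis by simp
    qed
    have "(curve_length s a \<gamma> + curve_length b u \<gamma>) + curve_length a b \<gamma>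
        \<le> (curve_length s a \<gamma> + curve_length b u \<gamma>) + (ennreal (e / 2) + ennreal (e / 2))"
      using order_trans[OF near[unfolded add] add_right_mono[OF S, of "ennreal (e / 2)"]]
      by (simp add: ac_simps)
    moreover have "curve_length s a \<gamma> + curve_length b u \<gamma> \<noteq> \<infinity>"
      using Lfin unfolding add by auto
    ultimately have "curve_length a b \<gamma> \<le> ennreal (e / 2) + ennreal (e / 2)"
      unfolding ennreal_add_left_cancel_le by blast
    then show ?thesis using e by (simp add: ennreal_plus[symmetric] del: ennreal_plus)
  qed
  then show ?thesis using \<delta>(1) by blast
qed

end

section \<open>Arc length parametrization and line integrals\<close>

context Metric_space
begin

lemma curve_length_finite:
  assumes "curve s u \<gamma>" "rectifiable s u \<gamma>" "s \<le> a" "a \<le> b" "b \<le> u"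
  shows "curve_length a b \<gamma> < \<infinity>"
  using curve_length_mono[of s a b u \<gamma>] assms by (auto simp: rectifiable_def curve_iff)

lemma curve_length_split:
  assumes "curve s u \<gamma>" "s \<le> a" "a \<le> b" "b \<le> u"
  shows "curve_length s b \<gamma> = curve_length s a \<gamma> + curve_length a b \<gamma>"
  by (rule curve_length_additive) (use assms in \<open>auto simp: curve_iff\<close>)

lemma curve_length_refl [simp]: "\<gamma> s \<in> M \<Longrightarrow> curve_length s s \<gamma> = 0"
  using curve_length_Lipschitz_le[of s s \<gamma> 0] by (auto simp: antisym_conv)

text \<open>The arc length function is continuous, so the intermediate value theorem applies.\<close>

lemma arc_length_attained:
  assumes \<gamma>: "curve s u \<gamma>" "rectifiable s u \<gamma>" and r: "r \<in> {0..enn2real (curve_length s u \<gamma>)}"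
  shows "\<exists>t\<in>{s..u}. curve_length s t \<gamma> = ennreal r"
proof -
  define l where "l t = enn2real (curve_length s t \<gamma>)" for t
  have fin: "curve_length a b \<gamma> < \<infinity>" if "s \<le> a" "a \<le> b" "b \<le> u" for a b
    using curve_length_finite[OF \<gamma> that] .
  have l_diff: "l b - l a = enn2real (curve_length a b \<gamma>)" if "s \<le> a" "a \<le> b" "b \<le> u" for a b
    using curve_length_split[OF \<gamma>(1) that] fin[of s a] fin[of a b] that
    by (simp add: l_def enn2real_plus)
  have su: "s \<le> u" using \<gamma> by (simp add: curve_def)
  have "continuous_on {s..u} l"
    unfolding continuous_on_iff
  proof (intro ballI allI impI)
    fix t e assume t: "t \<in> {s..u}" and e: "0 < (e::real)"
    obtain \<delta> where \<delta>: "\<delta> > 0" "\<And>a b. s \<le> a \<Longrightarrow> a \<le> b \<Longrightarrow> b \<le> u \<Longrightarrow> \<bar>a - t\<bar> < \<delta> \<Longrightarrow> \<bar>b - t\<bar> < \<delta>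
      \<Longrightarrow> curve_length a b \<gamma> \<le> ennreal (e / 2)"
      using curve_length_small[OF \<gamma> t, of "e / 2"] e by auto
    have "\<bar>l b - l a\<bar> < e" if "s \<le> a" "a \<le> b" "b \<le> u" "\<bar>a - t\<bar> < \<delta>" "\<bar>b - t\<bar> < \<delta>" for a b
      using enn2real_mono[OF \<delta>(2)[OF that]] l_diff[OF that(1-3)] e by simp
    from this[of t] this[of _ t] show "\<exists>d>0. \<forall>x'\<in>{s..u}. dist x' t < d \<longrightarrow> dist (l x') (l t) < e"
      using \<delta>(1) t by (intro exI[of _ \<delta>]) (auto simp: dist_real_def abs_minus_commute, smt (verit))
  qed
  moreover have "l s \<le> r" "r \<le> l u" using r su curve_in_M[OF \<gamma>(1), of s] by (auto simp: l_def)
  ultimately obtain t where t: "s \<le> t" "t \<le> u" "l t = r"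
    using IVT'[of l s r u] su by auto
  then show ?thesis using fin[of s t] by (intro bexI[of _ t]) (auto simp: l_def)
qed

text \<open>Between two parameters with the same arc length the curve has length \<open>0\<close> and is constant.\<close>

lemma arc_length_param_eq:
  assumes \<gamma>: "curve s u \<gamma>" "rectifiable s u \<gamma>" and t: "t \<in> {s..u}"
    and r: "curve_length s t \<gamma> = ennreal r"
  shows "arc_length_param s u \<gamma> r = \<gamma> t"
proof -
  have same: "\<gamma> a = \<gamma> b"
    if "s \<le> a" "a \<le> b" "b \<le> u" "curve_length s a \<gamma> = curve_length s b \<gamma>" for a b
  proof -
    have "curve_length s a \<gamma> + curve_length a b \<gamma> = curve_length s a \<gamma> + 0"
      using curve_length_split[OF \<gamma>(1) that(1-3)] that(4) by simp
    then have "curve_length a b \<gamma> = 0"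
      using curve_length_finite[OF \<gamma>, of s a] that unfolding ennreal_add_left_cancel by auto
    then have "d (\<gamma> a) (\<gamma> b) \<le> 0" using dist_le_curve_length[OF that(2), of \<gamma>] by simp
    then have "d (\<gamma> a) (\<gamma> b) = 0" using nonneg[of "\<gamma> a" "\<gamma> b"] by simp
    moreover have "\<gamma> a \<in> M" "\<gamma> b \<in> M" using that(1-3) by (auto intro: curve_in_M[OF \<gamma>(1)])
    ultimately show ?thesis using zero by blast
  qed
  define t' where "t' = inv_into {s..u} (\<lambda>t. curve_length s t \<gamma>) (ennreal r)"
  have "ennreal r \<in> (\<lambda>t. curve_length s t \<gamma>) ` {s..u}" using t r by force
  then have t': "t' \<in> {s..u}" "curve_length s t' \<gamma> = ennreal r"
    unfolding t'_def by (fact inv_into_into, fact f_inv_into_f)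
  have "\<gamma> t' = \<gamma> t"
  proof (cases "t \<le> t'")
    case True
    then have "\<gamma> t = \<gamma> t'" by (intro same) (use t t' r in auto)
    then show ?thesis by simp
  next
    case False
    then show ?thesis by (intro same) (use t t' r in auto)
  qed
  then show ?thesis unfolding arc_length_param_def t'_def .
qed

lemma arc_length_paramE:
  assumes "curve s u \<gamma>" "rectifiable s u \<gamma>" "r \<in> {0..enn2real (curve_length s u \<gamma>)}"
  obtains t where "t \<in> {s..u}" "curve_length s t \<gamma> = ennreal r" "arc_length_param s u \<gamma> r = \<gamma> t"
  using arc_length_attained[OF assms] arc_length_param_eq[OF assms(1,2)] by blast

text \<open>The arc between two points is at least as long as their distance.\<close>

lemma arc_length_param_1Lipschitz:
  assumes \<gamma>: "curve s u \<gamma>" "rectifiable s u \<gamma>"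
    and r: "0 \<le> r" "r \<le> r'" "r' \<le> enn2real (curve_length s u \<gamma>)"
  shows "d (arc_length_param s u \<gamma> r) (arc_length_param s u \<gamma> r') \<le> r' - r"
proof -
  obtain t where t: "t \<in> {s..u}" "curve_length s t \<gamma> = ennreal r" "arc_length_param s u \<gamma> r = \<gamma> t"
    by (rule arc_length_paramE[OF \<gamma>, of r]) (use r in auto)
  obtain t' where t': "t' \<in> {s..u}" "curve_length s t' \<gamma> = ennreal r'" "arc_length_param s u \<gamma> r' = \<gamma> t'"
    by (rule arc_length_paramE[OF \<gamma>, of r']) (use r in auto)
  have *: "ennreal (d (\<gamma> a) (\<gamma> b)) + curve_length s a \<gamma> \<le> curve_length s b \<gamma>"
    if "s \<le> a" "a \<le> b" "b \<le> u" for a b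
    using curve_length_split[OF \<gamma>(1) that] dist_le_curve_length[OF that(2), of \<gamma>]
    by (simp add: add.commute add_right_mono)
  show ?thesis
  proof (cases "t \<le> t'")
    case True
    then have "ennreal (d (\<gamma> t) (\<gamma> t') + r) \<le> ennreal r'"
      using *[of t t'] t t' r by (simp add: ennreal_plus)
    then show ?thesis using t t' r by (simp add: ennreal_le_iff del: ennreal_plus)
  next
    case False
    then have "ennreal (d (\<gamma> t') (\<gamma> t) + r') \<le> ennreal r"
      using *[of t' t] t t' r by (simp add: ennreal_plus)
    then show ?thesis using t t' r nonneg[of "\<gamma> t'" "\<gamma> t"] by (simp add: ennreal_le_iff commute del: ennreal_plus)
  qed
qed

lemma arc_length_param_start:
  assumes "curve s u \<gamma>" "rectifiable s u \<gamma>"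
  shows "arc_length_param s u \<gamma> 0 = \<gamma> s"
  using assms curve_in_M[OF assms(1), of s]
  by (intro arc_length_param_eq) (auto simp: curve_def)

lemma line_integral_cong:
  assumes "\<And>r. r \<in> {0..enn2real (curve_length s u \<gamma>)} \<Longrightarrow>
      f (arc_length_param s u \<gamma> r) = g r"
    and "L = enn2real (curve_length s u \<gamma>)"
  shows "line_integral f s u \<gamma> = (\<integral>\<^sup>+ r \<in> {0..L}. ennreal (g r) \<partial>lborel)"
  unfolding line_integral_def assms(2)
  by (intro nn_integral_cong) (auto simp: indicator_def assms(1))

lemma line_integral_le:
  assumes \<gamma>: "curve s u \<gamma>" "rectifiable s u \<gamma>"
    and B: "\<And>t. t \<in> {s..u} \<Longrightarrow> f (\<gamma> t) \<le> B" "0 \<le> B"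
  shows "line_integral f s u \<gamma> \<le> ennreal B * curve_length s u \<gamma>"
proof -
  let ?L = "enn2real (curve_length s u \<gamma>)"
  have "line_integral f s u \<gamma> \<le> (\<integral>\<^sup>+ r. ennreal B * indicator {0..?L} r \<partial>lborel)"
    unfolding line_integral_def
  proof (rule nn_integral_mono)
    fix r
    have "f (arc_length_param s u \<gamma> r) \<le> B" if "r \<in> {0..?L}"
      using arc_length_paramE[OF \<gamma> that] B(1) by metis
    then show "ennreal (f (arc_length_param s u \<gamma> r)) * indicator {0..?L} r \<le> ennreal B * indicator {0..?L} r"
      by (auto simp: indicator_def ennreal_leI)
  qed
  also have "\<dots> = ennreal B * curve_length s u \<gamma>"
    using \<gamma> by (simp add: nn_integral_cmult_indicator rectifiable_def)
  finally show ?thesis .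
qed

text \<open>The point at arc length \<open>r\<close> on the reversed curve is the point at arc length \<open>L - r\<close> on the curve itself, where
\<open>L\<close> is the total length; the reflection \<open>r \<mapsto> L - r\<close> preserves Lebesgue measure.\<close>

lemma line_integral_reverse:
  assumes \<gamma>: "curve s u \<gamma>" "rectifiable s u \<gamma>"
    and meas: "(\<lambda>r. f (arc_length_param s u \<gamma> r))
      \<in> borel_measurable (restrict_space borel {0..enn2real (curve_length s u \<gamma>)})"
  shows "line_integral f (- u) (- s) (\<lambda>t. \<gamma> (- t)) = line_integral f s u \<gamma>"
proof -
  let ?L = "enn2real (curve_length s u \<gamma>)"
  let ?\<gamma> = "\<lambda>t. \<gamma> (- t)"
  have \<gamma>': "curve (- u) (- s) ?\<gamma>" "rectifiable (- u) (- s) ?\<gamma>"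
    using \<gamma> by (auto simp: curve_reverse rectifiable_def curve_length_reverse)
  have param: "arc_length_param (- u) (- s) ?\<gamma> r = arc_length_param s u \<gamma> (?L - r)" if r: "r \<in> {0..?L}" for r
  proof -
    have "?L - r \<in> {0..?L}" using r by auto
    then obtain t where t: "t \<in> {s..u}" "curve_length s t \<gamma> = ennreal (?L - r)"
        "arc_length_param s u \<gamma> (?L - r) = \<gamma> t"
      by (rule arc_length_paramE[OF \<gamma>])
    \<comment> \<open>The part of the curve after \<open>t\<close> has length \<open>r\<close>, since the part before it has length \<open>L - r\<close>.\<close>
    have "ennreal ?L = ennreal (?L - r) + curve_length t u \<gamma>"
      using curve_length_split[OF \<gamma>(1), of t u] t \<gamma>(2) by (simp add: rectifiable_def)
    moreover have "ennreal ?L = ennreal (?L - r) + ennreal r"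
      using r by (simp add: ennreal_plus[symmetric] del: ennreal_plus)
    ultimately have "curve_length t u \<gamma> = ennreal r"
      by (metis ennreal_add_left_cancel ennreal_neq_top infinity_ennreal_def)
    then have "curve_length (- u) (- t) ?\<gamma> = ennreal r" by (simp add: curve_length_reverse)
    then show ?thesis using arc_length_param_eq[OF \<gamma>', of "- t" r] t by simp
  qed
  define g where "g r = ennreal (f (arc_length_param s u \<gamma> r)) * indicator {0..?L} r" for r
  have [measurable]: "g \<in> borel_measurable borel"
    unfolding g_def using meas by (subst borel_measurable_restrict_space_iff_ennreal[symmetric]) auto
  have "line_integral f (- u) (- s) ?\<gamma> = (\<integral>\<^sup>+ r. g (?L + (- 1) * r) \<partial>lborel)"
    unfolding line_integral_def curve_length_reverse
    by (intro nn_integral_cong) (auto simp: g_def indicator_def param)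
  also have "\<dots> = (\<integral>\<^sup>+ r. g r \<partial>lborel)"
    using nn_integral_real_affine[of g "- 1" ?L] by simp
  finally show ?thesis by (simp add: g_def line_integral_def)
qed

text \<open>The parameters of \<open>\<gamma>'\<close> are moved so that its start \<open>s'\<close> meets the end \<open>u\<close> of \<open>\<gamma>\<close>.\<close>

definition join_at :: "real \<Rightarrow> (real \<Rightarrow> 'a) \<Rightarrow> real \<Rightarrow> (real \<Rightarrow> 'a) \<Rightarrow> real \<Rightarrow> 'a" where
  "join_at u \<gamma> s' \<gamma>' t = (if t \<le> u then \<gamma> t else \<gamma>' (t - (u - s')))"

text \<open>The arc length parametrization of the joined curve follows that of the first curve up to its length \<open>L\<close>
and then that of the second one, delayed by \<open>L\<close>. The common point \<open>r = L\<close> is counted in both integrals on the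
right-hand side, which is harmless for the inequality.\<close>

lemma
  assumes \<gamma>: "curve s u \<gamma>" "rectifiable s u \<gamma>"
    and \<gamma>': "curve s' u' \<gamma>'" "rectifiable s' u' \<gamma>'" and eq: "\<gamma> u = \<gamma>' s'"
  shows curve_join: "curve s (u + (u' - s')) (join_at u \<gamma> s' \<gamma>')"
    and curve_length_join: "curve_length s (u + (u' - s')) (join_at u \<gamma> s' \<gamma>')
        = curve_length s u \<gamma> + curve_length s' u' \<gamma>'"
    and line_integral_join:
      "\<lbrakk>(\<lambda>r. f (arc_length_param s u \<gamma> r))
          \<in> borel_measurable (restrict_space borel {0..enn2real (curve_length s u \<gamma>)});
        (\<lambda>r. f (arc_length_param s' u' \<gamma>' r))
          \<in> borel_measurable (restrict_space borel {0..enn2real (curve_length s' u' \<gamma>')})\<rbrakk>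
       \<Longrightarrow> line_integral f s (u + (u' - s')) (join_at u \<gamma> s' \<gamma>')
          \<le> line_integral f s u \<gamma> + line_integral f s' u' \<gamma>'"
proof -
  let ?u = "u + (u' - s')"
  let ?\<gamma> = "join_at u \<gamma> s' \<gamma>'"
  let ?c = "u - s'"
  let ?L = "enn2real (curve_length s u \<gamma>)"
  let ?L' = "enn2real (curve_length s' u' \<gamma>')"
  have ord: "s \<le> u" "s' \<le> u'" "u \<le> ?u" using \<gamma> \<gamma>' by (auto simp: curve_def)
  have left: "?\<gamma> t = \<gamma> t" if "t \<le> u" for t using that by (simp add: join_at_def)
  have right: "?\<gamma> t = \<gamma>' (t - ?c)" if "u \<le> t" for t using that eq by (auto simp: join_at_def)
  show c: "curve s ?u ?\<gamma>"
  proof -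
    have "continuous_map (top_of_set {u..?u}) (top_of_set {s'..u'}) (\<lambda>t. t - ?c)"
      by (auto simp: continuous_map_in_subtopology intro!: continuous_intros)
    then have 2: "continuous_map (top_of_set {u..?u}) mtopology (\<gamma>' \<circ> (\<lambda>t. t - ?c))"
      using \<gamma>' unfolding curve_def by (intro continuous_map_compose) auto
    have "continuous_map (top_of_set {s..?u}) mtopology (\<lambda>t. if t \<le> u then \<gamma> t else \<gamma>' (t - ?c))"
    proof (rule continuous_map_cases_le)
      have "subtopology (top_of_set {s..?u}) {t \<in> topspace (top_of_set {s..?u}). t \<le> u} = top_of_set {s..u}"
        "subtopology (top_of_set {s..?u}) {t \<in> topspace (top_of_set {s..?u}). u \<le> t} = top_of_set {u..?u}"
        unfolding subtopology_subtopology using ord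
        by (auto intro!: arg_cong[of _ _ "subtopology euclidean"])
      then show "continuous_map (subtopology (top_of_set {s..?u}) {t \<in> topspace (top_of_set {s..?u}). t \<le> u}) mtopology \<gamma>"
        "continuous_map (subtopology (top_of_set {s..?u}) {t \<in> topspace (top_of_set {s..?u}). u \<le> t}) mtopology (\<lambda>t. \<gamma>' (t - ?c))"
        using \<gamma> 2 by (auto simp: curve_def o_def)
    qed (auto simp: eq)
    then show ?thesis using ord by (auto simp: curve_def join_at_def[abs_def])
  qed
  have len1: "curve_length s t ?\<gamma> = curve_length s t \<gamma>" if "t \<le> u" for t
    by (rule curve_length_cong) (use that left in auto)
  have len2: "curve_length s (t + ?c) ?\<gamma> = curve_length s u \<gamma> + curve_length s' t \<gamma>'"
    if "s' \<le> t" "t \<le> u'" for t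
  proof -
    have "curve_length u (t + ?c) ?\<gamma> = curve_length (s' + ?c) (t + ?c) (\<lambda>r. \<gamma>' (r - ?c))"
      by (simp, rule curve_length_cong) (use right in auto)
    also have "\<dots> = curve_length s' t \<gamma>'" by (rule curve_length_shift)
    finally show ?thesis
      using curve_length_split[OF c, of u "t + ?c"] that ord len1[of u] by simp
  qed
  show len: "curve_length s ?u ?\<gamma> = curve_length s u \<gamma> + curve_length s' u' \<gamma>'"
    using len2[of u'] ord by (simp add: algebra_simps)
  have rect: "rectifiable s ?u ?\<gamma>"
    using len \<gamma>(2) \<gamma>'(2) by (simp add: rectifiable_def)
  have L: "enn2real (curve_length s ?u ?\<gamma>) = ?L + ?L'"
    using \<gamma>(2) \<gamma>'(2) unfolding len by (intro enn2real_plus) (auto simp: rectifiable_def)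
  assume meas: "(\<lambda>r. f (arc_length_param s u \<gamma> r)) \<in> borel_measurable (restrict_space borel {0..?L})"
    "(\<lambda>r. f (arc_length_param s' u' \<gamma>' r)) \<in> borel_measurable (restrict_space borel {0..?L'})"
  define g where "g r = ennreal (f (arc_length_param s u \<gamma> r)) * indicator {0..?L} r" for r
  define g' where "g' r = ennreal (f (arc_length_param s' u' \<gamma>' r)) * indicator {0..?L'} r" for r
  have [measurable]: "g \<in> borel_measurable borel"
    unfolding g_def using meas(1) by (subst borel_measurable_restrict_space_iff_ennreal[symmetric]) auto
  have [measurable]: "g' \<in> borel_measurable borel"
    unfolding g'_def using meas(2) by (subst borel_measurable_restrict_space_iff_ennreal[symmetric]) auto
  have p1: "arc_length_param s ?u ?\<gamma> r = arc_length_param s u \<gamma> r" if r: "r \<in> {0..?L}" for r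
  proof -
    obtain t where "t \<in> {s..u}" "curve_length s t \<gamma> = ennreal r" "arc_length_param s u \<gamma> r = \<gamma> t"
      by (rule arc_length_paramE[OF \<gamma> r])
    then show ?thesis using arc_length_param_eq[OF c rect, of t r] len1[of t] left[of t] ord by auto
  qed
  have p2: "arc_length_param s ?u ?\<gamma> (?L + r) = arc_length_param s' u' \<gamma>' r" if r: "r \<in> {0..?L'}" for r
  proof -
    obtain t where t: "t \<in> {s'..u'}" "curve_length s' t \<gamma>' = ennreal r" "arc_length_param s' u' \<gamma>' r = \<gamma>' t"
      by (rule arc_length_paramE[OF \<gamma>' r])
    have "curve_length s (t + ?c) ?\<gamma> = ennreal (?L + r)"
      using len2[of t] t r \<gamma>(2) by (simp add: rectifiable_def ennreal_plus)
    then show ?thesis using arc_length_param_eq[OF c rect, of "t + ?c"] right[of "t + ?c"] ord t by auto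
  qed
  have "line_integral f s ?u ?\<gamma> \<le> (\<integral>\<^sup>+ r. g r + g' (- ?L + 1 * r) \<partial>lborel)"
    unfolding line_integral_def
  proof (rule nn_integral_mono)
    fix r
    consider "r \<in> {0..?L}" | "r \<notin> {0..?L}" "r - ?L \<in> {0..?L'}" | "r \<notin> {0..?L + ?L'}"
      by fastforce
    then show "ennreal (f (arc_length_param s ?u ?\<gamma> r)) * indicator {0..enn2real (curve_length s ?u ?\<gamma>)} r
        \<le> g r + g' (- ?L + 1 * r)"
    proof cases
      case 1
      then show ?thesis by (simp add: L g_def p1 indicator_def)
    next
      case 2
      then show ?thesis using p2[of "r - ?L"] by (simp add: L g'_def indicator_def)
    next
      case 3
      then show ?thesis by (auto simp: L indicator_def)
    qed
  qed
  also have "\<dots> = (\<integral>\<^sup>+ r. g r \<partial>lborel) + (\<integral>\<^sup>+ r. g' (- ?L + 1 * r) \<partial>lborel)"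
    by (rule nn_integral_add) auto
  also have "(\<integral>\<^sup>+ r. g' (- ?L + 1 * r) \<partial>lborel) = (\<integral>\<^sup>+ r. g' r \<partial>lborel)"
    using nn_integral_real_affine[of g' 1 "- ?L"] by simp
  finally show "line_integral f s ?u ?\<gamma> \<le> line_integral f s u \<gamma> + line_integral f s' u' \<gamma>'"
    by (simp add: g_def g'_def line_integral_def)
qed

end

section \<open>Curves in the completion\<close>

context Metric_space
begin

lemma curve_length_embed:
  assumes "\<gamma> ` {s..u} \<subseteq> M"
  shows "Metric_space.curve_length completion_dist s u (completion_embed \<circ> \<gamma>) = curve_length s u \<gamma>"
proof -
  interpret C: Metric_space completion completion_dist by (rule Metric_space_completion)
  have eq: "(\<Sum>i<n. ennreal (completion_dist ((completion_embed \<circ> \<gamma>) (t i)) ((completion_embed \<circ> \<gamma>) (t (Suc i)))))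
      = (\<Sum>i<n. ennreal (d (\<gamma> (t i)) (\<gamma> (t (Suc i)))))"
    if t: "t 0 = s" "t n = u" "mono_on {..n} t" for n and t :: "nat \<Rightarrow> real"
  proof (intro sum.cong refl)
    fix i assume "i \<in> {..<n}"
    then have "t i \<in> {s..u}" "t (Suc i) \<in> {s..u}" using partition_bounds[OF t] by auto
    then have "\<gamma> (t i) \<in> M" "\<gamma> (t (Suc i)) \<in> M" using assms by blast+
    then show "ennreal (completion_dist ((completion_embed \<circ> \<gamma>) (t i)) ((completion_embed \<circ> \<gamma>) (t (Suc i))))
        = ennreal (d (\<gamma> (t i)) (\<gamma> (t (Suc i))))"
      by (simp add: completion_dist_embed)
  qed
  show ?thesis
  proof (rule antisym)
    show "C.curve_length s u (completion_embed \<circ> \<gamma>) \<le> curve_length s u \<gamma>"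
      by (rule C.curve_length_leI) (simp only: eq, rule sum_le_curve_length)
    show "curve_length s u \<gamma> \<le> C.curve_length s u (completion_embed \<circ> \<gamma>)"
      by (rule curve_length_leI) (simp only: eq[symmetric], rule C.sum_le_curve_length)
  qed
qed

lemma curve_embed:
  assumes "curve s u \<gamma>"
  shows "Metric_space.curve completion completion_dist s u (completion_embed \<circ> \<gamma>)"
proof -
  interpret C: Metric_space completion completion_dist by (rule Metric_space_completion)
  have M: "\<gamma> t \<in> M" if "t \<in> {s..u}" for t using curve_in_M[OF assms that] .
  show ?thesis unfolding C.curve_iff
  proof (intro conjI ballI allI impI)
    show "s \<le> u" using assms by (simp add: curve_def)
    show "(completion_embed \<circ> \<gamma>) ` {s..u} \<subseteq> completion"
      using M completion_embed_in by (auto simp del: atLeastAtMost_iff)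
    fix t e assume t: "t \<in> {s..u}" and "0 < (e::real)"
    then obtain \<delta> where "\<delta> > 0" "\<forall>t'\<in>{s..u}. \<bar>t' - t\<bar> < \<delta> \<longrightarrow> d (\<gamma> t) (\<gamma> t') < e"
      using assms unfolding curve_iff by blast
    then show "\<exists>\<delta>>0. \<forall>t'\<in>{s..u}. \<bar>t' - t\<bar> < \<delta> \<longrightarrow>
        completion_dist ((completion_embed \<circ> \<gamma>) t) ((completion_embed \<circ> \<gamma>) t') < e"
      using M t by (intro exI[of _ \<delta>]) (simp add: completion_dist_embed del: atLeastAtMost_iff)
  qed
qed

lemma uniform_curve_embed_iff:
  assumes "curve s u \<gamma>"
  shows "uniform_curve C s u (completion_embed \<circ> \<gamma>) \<longleftrightarrow>
     curve_length s u \<gamma> \<le> ennreal C * ennreal (d (\<gamma> s) (\<gamma> u)) \<and>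
     (\<forall>t \<in> {s..u}. min (curve_length s t \<gamma>) (curve_length t u \<gamma>)
        \<le> ennreal C * (INF w \<in> metric_boundary. ennreal (completion_dist (completion_embed (\<gamma> t)) w)))"
proof -
  have M: "\<gamma> t \<in> M" if "t \<in> {s..u}" for t using curve_in_M[OF assms that] .
  have "s \<le> u" using assms by (simp add: curve_def)
  then have 1: "completion_dist ((completion_embed \<circ> \<gamma>) s) ((completion_embed \<circ> \<gamma>) u) = d (\<gamma> s) (\<gamma> u)"
    using M[of s] M[of u] by (simp add: completion_dist_embed)
  have 2: "Metric_space.curve_length completion_dist a b (completion_embed \<circ> \<gamma>) = curve_length a b \<gamma>"
    if "s \<le> a" "b \<le> u" for a b
    by (rule curve_length_embed) (use M that in auto)
  show ?thesis
    unfolding uniform_curve_def using curve_embed[OF assms] 1 2 \<open>s \<le> u\<close> by auto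
qed

end


section \<open>The Euclidean half-plane is uniform\<close>

lemma Metric_space_dist: "Metric_space (M :: 'a::metric_space set) dist"
  by unfold_locales (auto simp: dist_commute dist_triangle)

lemma mtopology_dist: "Metric_space.mtopology (M :: 'a::metric_space set) dist = top_of_set M"
proof -
  interpret Submetric UNIV dist M by unfold_locales auto
  show ?thesis using mtopology_submetric by simp
qed

lemma mem_upper_half_plane: "z \<in> upper_half_plane \<longleftrightarrow> 0 < snd z"
  by (cases z) (auto simp: upper_half_plane_def)

interpretation H: Metric_space upper_half_plane dist
  by (rule Metric_space_dist)

lemma MCauchy_dist_iff:
  "Metric_space.MCauchy (M :: 'a::metric_space set) dist \<sigma> \<longleftrightarrow> range \<sigma> \<subseteq> M \<and> Cauchy \<sigma>"
proof -
  have "(\<forall>n n'. N \<le> n \<longrightarrow> N \<le> n' \<longrightarrow> dist (\<sigma> n) (\<sigma> n') < e)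
      \<longleftrightarrow> (\<forall>n\<ge>N. \<forall>n'\<ge>N. dist (\<sigma> n) (\<sigma> n') < e)" for N e
    by blast
  then show ?thesis unfolding Metric_space.MCauchy_def[OF Metric_space_dist] Cauchy_def by simp
qed

text \<open>A representative of a boundary point converges in the plane, and its limit is not in the open half-plane,
since otherwise the boundary point would be the image of that limit.\<close>

lemma height_le_boundary_dist:
  assumes z: "z \<in> upper_half_plane" and w: "w \<in> H.metric_boundary"
  shows "snd z \<le> H.completion_dist (H.completion_embed z) w"
proof -
  have wc: "w \<in> H.completion" using w by (simp add: H.metric_boundary_def)
  then obtain \<sigma> where \<sigma>: "\<sigma> \<in> w" "H.MCauchy \<sigma>" by (rule H.completion_nonempty)
  then have "Cauchy \<sigma>" and range: "range \<sigma> \<subseteq> upper_half_plane" by (auto simp: MCauchy_dist_iff)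
  then obtain p where p: "\<sigma> \<longlonglongrightarrow> p" by (auto simp: Cauchy_convergent_iff convergent_def)
  have "p \<notin> upper_half_plane"
  proof
    assume pH: "p \<in> upper_half_plane"
    have "(\<lambda>n. dist p (\<sigma> n)) \<longlonglongrightarrow> 0" using tendsto_dist[OF tendsto_const p, of p] by simp
    then have "((\<lambda>_. p), \<sigma>) \<in> H.Cauchy_rel" using \<sigma> pH by (simp add: H.Cauchy_rel_def)
    moreover have "(\<lambda>_. p) \<in> H.completion_embed p"
      using pH by (simp add: H.completion_embed_def H.Cauchy_rel_def)
    ultimately have "H.completion_embed p = w"
      using quotient_eq_iff[OF H.equiv_Cauchy_rel H.completion_embed_in[OF pH, unfolded H.completion_def]
          wc[unfolded H.completion_def] _ \<sigma>(1)] by blast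
    then show False using w pH by (auto simp: H.metric_boundary_def)
  qed
  then have "snd p \<le> 0" by (simp add: mem_upper_half_plane)
  moreover have "snd z - snd p \<le> dist z p"
    using dist_snd_le[of z p] by (simp add: dist_real_def)
  moreover have "(\<lambda>n. dist z (\<sigma> n)) \<longlonglongrightarrow> H.completion_dist (H.completion_embed z) w"
  proof (rule H.completion_dist_lim)
    show "(\<lambda>_. z) \<in> H.completion_embed z"
      using z by (simp add: H.completion_embed_def H.Cauchy_rel_def)
  qed (use z wc \<sigma> H.completion_embed_in in auto)
  moreover have "(\<lambda>n. dist z (\<sigma> n)) \<longlonglongrightarrow> dist z p" by (intro tendsto_intros p)
  ultimately have "H.completion_dist (H.completion_embed z) w = dist z p" "snd z \<le> dist z p"
    by (blast intro: LIMSEQ_unique, linarith)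
  then show ?thesis by simp
qed

text \<open>Jordan's inequality: on \<open>{0..pi / 2}\<close> the concave function \<open>sin\<close> lies above its chord.\<close>

lemma sin_Jordan:
  fixes x :: real
  assumes "0 \<le> x" "x \<le> pi / 2"
  shows "x \<le> pi / 2 * sin x"
proof -
  have "convex_on {0..pi/2} (\<lambda>x::real. - sin x)"
    by (rule f''_ge0_imp_convex[where f' = "\<lambda>x. - cos x" and f'' = sin])
       (auto intro!: derivative_eq_intros sin_ge_zero)
  from convex_onD[OF this, of "x / (pi / 2)" 0 "pi / 2"] show ?thesis
    using assms by (simp add: field_simps)
qed

lemma min_angle_le: "0 \<le> \<theta> \<Longrightarrow> \<theta> \<le> pi \<Longrightarrow> min \<theta> (pi - \<theta>) \<le> pi / 2 * sin \<theta>"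
  using sin_Jordan[of \<theta>] sin_Jordan[of "pi - \<theta>"] by (cases "\<theta> \<le> pi / 2") (auto simp: min_def)

definition half_circle :: "real \<Rightarrow> real \<Rightarrow> real \<Rightarrow> real \<times> real" where
  "half_circle c R \<theta> = (c + R * cos \<theta>, R * sin \<theta>)"

lemma dist_half_circle:
  assumes "R \<ge> 0"
  shows "dist (half_circle c R \<alpha>) (half_circle c R \<beta>) = 2 * R * \<bar>sin ((\<alpha> - \<beta>) / 2)\<bar>"
proof -
  have "(R * cos \<alpha> - R * cos \<beta>)\<^sup>2 + (R * sin \<alpha> - R * sin \<beta>)\<^sup>2
      = R\<^sup>2 * (((sin \<alpha>)\<^sup>2 + (cos \<alpha>)\<^sup>2) + ((sin \<beta>)\<^sup>2 + (cos \<beta>)\<^sup>2) - 2 * cos (\<alpha> - \<beta>))"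
    unfolding cos_diff by algebra
  also have "\<dots> = R\<^sup>2 * (2 - 2 * cos (2 * ((\<alpha> - \<beta>) / 2)))"
    unfolding sin_cos_squared_add nonzero_mult_div_cancel_left[OF numeral_neq_zero] times_divide_eq_right by simp
  also have "\<dots> = (2 * R * sin ((\<alpha> - \<beta>) / 2))\<^sup>2"
    unfolding cos_double_sin by algebra
  finally show ?thesis
    using assms by (simp add: half_circle_def dist_Pair_Pair dist_real_def abs_mult)
qed

lemma dist_half_circle_le:
  assumes "R \<ge> 0"
  shows "dist (half_circle c R \<alpha>) (half_circle c R \<beta>) \<le> R * \<bar>\<alpha> - \<beta>\<bar>"
  using mult_left_mono[OF abs_sin_x_le_abs_x[of "(\<alpha> - \<beta>) / 2"], of "2 * R"] assms
  by (simp add: dist_half_circle)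

lemma half_circle_in_upper_half_plane:
  "R > 0 \<Longrightarrow> 0 < \<theta> \<Longrightarrow> \<theta> < pi \<Longrightarrow> half_circle c R \<theta> \<in> upper_half_plane"
  by (simp add: half_circle_def mem_upper_half_plane sin_gt_zero)

text \<open>Polar coordinates centered at the point \<open>(c, 0)\<close> of the boundary line.\<close>

lemma half_circle_obtain:
  assumes "z \<in> upper_half_plane"
  obtains \<theta> where "0 < \<theta>" "\<theta> < pi" "z = half_circle c (dist (c, 0) z) \<theta>"
proof -
  obtain x y where z: "z = (x, y)" "y > 0" using assms by (cases z) (auto simp: mem_upper_half_plane)
  define R where "R = dist (c, 0) z"
  have R2: "R\<^sup>2 = (x - c)\<^sup>2 + y\<^sup>2"
    by (simp add: R_def z dist_Pair_Pair dist_real_def power2_commute)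
  have R: "R > 0" using z by (simp add: R_def)
  define q where "q = (x - c) / R"
  have q2: "1 - q\<^sup>2 = (y / R)\<^sup>2" 
  proof -
    have "1 - q\<^sup>2 = (R\<^sup>2 - (x - c)\<^sup>2) / R\<^sup>2"
      using R unfolding q_def power_divide by (simp add: diff_divide_distrib)
    then show ?thesis by (simp add: R2 power_divide)
  qed
  have "0 < (y / R)\<^sup>2" using z R by simp
  then have "q\<^sup>2 < 1" using q2 by linarith
  then have q: "- 1 < q" "q < 1" by (auto simp: abs_square_less_1 abs_less_iff)
  have "sin (arccos q) = y / R"
    using q z R by (simp add: sin_arccos q2)
  moreover have "cos (arccos q) = q" using q by simp
  ultimately have "z = half_circle c R (arccos q)"
    using R by (simp add: half_circle_def z q_def)
  then show ?thesis using that arccos_lt_bounded[OF q] R_def by auto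
qed

text \<open>For a curve on \<open>{0..1}\<close> of speed at most \<open>K\<close> both uniformity conditions follow from estimates between
real numbers, because the height of a point bounds its distance to the boundary from below.\<close>

lemma half_plane_uniform_curveI:
  assumes \<gamma>: "\<gamma> ` {0..1} \<subseteq> upper_half_plane"
    and lip: "\<And>r r'. 0 \<le> r \<Longrightarrow> r \<le> r' \<Longrightarrow> r' \<le> 1 \<Longrightarrow> dist (\<gamma> r) (\<gamma> r') \<le> K * (r' - r)"
    and K: "K \<le> C * dist (\<gamma> 0) (\<gamma> 1)"
    and height: "\<And>t. 0 \<le> t \<Longrightarrow> t \<le> 1 \<Longrightarrow> K * min t (1 - t) \<le> C * snd (\<gamma> t)"
    and C: "C \<ge> 1"
  shows "H.curve 0 1 \<gamma>" "H.uniform_curve C 0 1 (H.completion_embed \<circ> \<gamma>)"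
proof -
  show c: "H.curve 0 1 \<gamma>" by (rule H.Lipschitz_curve[OF _ \<gamma> lip]) auto
  have K0: "0 \<le> K" using order_trans[OF zero_le_dist lip[of 0 1]] by simp
  have len: "H.curve_length a b \<gamma> \<le> ennreal (K * (b - a))" if "0 \<le> a" "b \<le> 1" for a b
    by (rule H.curve_length_Lipschitz_le) (use lip that in auto)
  show "H.uniform_curve C 0 1 (H.completion_embed \<circ> \<gamma>)"
    unfolding H.uniform_curve_embed_iff[OF c]
  proof (intro conjI ballI)
    have "H.curve_length 0 1 \<gamma> \<le> ennreal K" using len[of 0 1] by simp
    also have "\<dots> \<le> ennreal (C * dist (\<gamma> 0) (\<gamma> 1))" using K by (rule ennreal_leI)
    finally show "H.curve_length 0 1 \<gamma> \<le> ennreal C * ennreal (dist (\<gamma> 0) (\<gamma> 1))"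
      using C by (simp add: ennreal_mult)
  next
    fix t :: real assume t: "t \<in> {0..1}"
    have "min (H.curve_length 0 t \<gamma>) (H.curve_length t 1 \<gamma>) \<le> min (ennreal (K * t)) (ennreal (K * (1 - t)))"
      using len[of 0 t] len[of t 1] t by (intro min.mono) auto
    also have "\<dots> = ennreal (K * min t (1 - t))"
    proof (cases "t \<le> 1 - t")
      case True
      then show ?thesis using t K0 by (simp add: min_absorb1 ennreal_leI mult_left_mono)
    next
      case False
      then show ?thesis using t K0 by (simp add: min_absorb2 ennreal_leI mult_left_mono)
    qed
    also have "\<dots> \<le> ennreal (C * snd (\<gamma> t))" using height[of t] t by (intro ennreal_leI) auto
    also have "\<dots> = ennreal C * ennreal (snd (\<gamma> t))"
      using C t \<gamma> by (intro ennreal_mult) (auto simp: mem_upper_half_plane image_subset_iff less_imp_le)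
    also have "\<dots> \<le> ennreal C * (INF w \<in> H.metric_boundary. ennreal (H.completion_dist (H.completion_embed (\<gamma> t)) w))"
      using t \<gamma> by (intro mult_left_mono INF_greatest ennreal_leI height_le_boundary_dist) auto
    finally show "min (H.curve_length 0 t \<gamma>) (H.curve_length t 1 \<gamma>) \<le> \<dots>" .
  qed
qed

text \<open>Two points on a common vertical line are joined by a segment. Otherwise some circle centered on the
boundary line passes through both, and its arc between them is run through at constant speed. The angle
\<open>\<theta>\<close> may increase or decrease on the way; in both cases the part of the arc from the start and the part up to
the end cannot both have an opening angle above \<open>min \<theta> (pi - \<theta>)\<close>.\<close>

lemma half_plane_uniform_curve_exists:
  assumes x: "x \<in> upper_half_plane" and y: "y \<in> upper_half_plane"
  shows "\<exists>s u \<gamma>. H.curve s u \<gamma> \<and> \<gamma> s = x \<and> \<gamma> u = y \<and> H.uniform_curve (pi / 2) s u (H.completion_embed \<circ> \<gamma>)"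
proof -
  have pi2: "1 \<le> pi / 2" using pi_gt3 by simp
  have "\<exists>\<gamma> K. \<gamma> 0 = x \<and> \<gamma> 1 = y \<and> \<gamma> ` {0..1} \<subseteq> upper_half_plane \<and>
      (\<forall>r r'. 0 \<le> r \<longrightarrow> r \<le> r' \<longrightarrow> r' \<le> 1 \<longrightarrow> dist (\<gamma> r) (\<gamma> r') \<le> K * (r' - r)) \<and>
      K \<le> pi / 2 * dist (\<gamma> 0) (\<gamma> 1) \<and>
      (\<forall>t. 0 \<le> t \<longrightarrow> t \<le> 1 \<longrightarrow> K * min t (1 - t) \<le> pi / 2 * snd (\<gamma> t))"
  proof (cases "fst x = fst y")
    case True
    obtain p a b where xy: "x = (p, a)" "y = (p, b)" "a > 0" "b > 0"
      using True x y by (cases x; cases y) (auto simp: mem_upper_half_plane)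
    define \<gamma> where "\<gamma> t = (p, (1 - t) * a + t * b)" for t
    have pos: "0 < (1 - t) * a + t * b" if "0 \<le> t" "t \<le> 1" for t
      using that xy by (cases "t = 0") (auto intro!: add_nonneg_pos)
    have "dist (\<gamma> r) (\<gamma> r') \<le> \<bar>b - a\<bar> * (r' - r)" if "r \<le> r'" for r r'
    proof -
      have "((1 - r) * a + r * b) - ((1 - r') * a + r' * b) = (b - a) * (r - r')" by (simp add: algebra_simps)
      then show ?thesis using that by (simp add: \<gamma>_def dist_Pair_Pair dist_real_def abs_mult)
    qed
    moreover have "\<bar>b - a\<bar> \<le> pi / 2 * dist (\<gamma> 0) (\<gamma> 1)"
      using mult_right_mono[OF pi2, of "\<bar>b - a\<bar>"] 
      by (simp add: \<gamma>_def dist_Pair_Pair dist_real_def abs_minus_commute)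
    moreover have "\<bar>b - a\<bar> * min t (1 - t) \<le> pi / 2 * snd (\<gamma> t)" if t: "0 \<le> t" "t \<le> 1" for t
    proof -
      have "\<bar>b - a\<bar> * min t (1 - t) \<le> (1 - t) * a + t * b"
      proof (cases "a \<le> b")
        case True
        have "\<bar>b - a\<bar> * min t (1 - t) \<le> (b - a) * t" using True t by (auto intro!: mult_mono)
        then show ?thesis using xy by (simp add: algebra_simps)
      next
        case False
        have "\<bar>b - a\<bar> * min t (1 - t) \<le> (a - b) * (1 - t)" using False t by (auto intro!: mult_mono)
        then show ?thesis using xy by (simp add: algebra_simps)
      qed
      also have "\<dots> \<le> pi / 2 * ((1 - t) * a + t * b)"
        using mult_right_mono[OF pi2, of "(1 - t) * a + t * b"] pos[OF t] by simp
      finally show ?thesis by (simp add: \<gamma>_def)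
    qed
    ultimately show ?thesis
      using pos by (intro exI[of _ \<gamma>] exI[of _ "\<bar>b - a\<bar>"]) (auto simp: \<gamma>_def xy mem_upper_half_plane)
  next
    case False
    \<comment> \<open>The point \<open>(c, 0)\<close> is the intersection of the boundary line with the perpendicular bisector of \<open>x\<close> and \<open>y\<close>.\<close>
    define c where "c = ((norm y)\<^sup>2 - (norm x)\<^sup>2) / (2 * (fst y - fst x))"
    define R where "R = dist (c, 0) x"
    have norm2: "(dist (c, 0) z)\<^sup>2 = (norm z)\<^sup>2 - 2 * c * fst z + c\<^sup>2" for z :: "real \<times> real"
    proof (cases z)
      case (Pair a b)
      have "(dist (c, 0) z)\<^sup>2 = (c - a)\<^sup>2 + b\<^sup>2"
        by (simp add: Pair dist_Pair_Pair dist_real_def)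
      moreover have "(norm z)\<^sup>2 = a\<^sup>2 + b\<^sup>2" by (simp add: Pair norm_Pair)
      ultimately show ?thesis by (simp add: Pair power2_diff)
    qed
    have "c * (2 * (fst y - fst x)) = (norm y)\<^sup>2 - (norm x)\<^sup>2"
      using False unfolding c_def by (simp add: divide_eq_eq)
    then have "(dist (c, 0) x)\<^sup>2 = (dist (c, 0) y)\<^sup>2"
      unfolding norm2 by (simp add: algebra_simps)
    then have R': "R = dist (c, 0) y" by (simp add: R_def)
    have R: "R > 0" using x by (cases x) (auto simp: R_def mem_upper_half_plane)
    obtain \<alpha> where \<alpha>: "0 < \<alpha>" "\<alpha> < pi" "x = half_circle c R \<alpha>"
      using half_circle_obtain[OF x] unfolding R_def by metis
    obtain \<beta> where \<beta>: "0 < \<beta>" "\<beta> < pi" "y = half_circle c R \<beta>"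
      using half_circle_obtain[OF y] unfolding R' by metis
    define \<theta> where "\<theta> t = \<alpha> + t * (\<beta> - \<alpha>)" for t
    have \<theta>: "0 < \<theta> t" "\<theta> t < pi" "\<bar>\<beta> - \<alpha>\<bar> * min t (1 - t) \<le> min (\<theta> t) (pi - \<theta> t)"
      if t: "0 \<le> t" "t \<le> 1" for t
    proof -
      have eq: "\<theta> t = (1 - t) * \<alpha> + t * \<beta>" "pi - \<theta> t = (1 - t) * (pi - \<alpha>) + t * (pi - \<beta>)"
        by (auto simp: \<theta>_def algebra_simps)
      have p: "0 \<le> (1 - t) * \<alpha>" "0 \<le> t * \<beta>" "0 \<le> (1 - t) * (pi - \<alpha>)" "0 \<le> t * (pi - \<beta>)"
        using t \<alpha> \<beta> by auto
      show "0 < \<theta> t" using t \<alpha> \<beta> p unfolding eq(1) by (cases "t = 0") (auto intro!: add_nonneg_pos)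
      have "0 < (1 - t) * (pi - \<alpha>) + t * (pi - \<beta>)"
      proof (cases "t = 0")
        case False
        then have "0 < t * (pi - \<beta>)" using t \<beta> by simp
        then show ?thesis using p(3) by linarith
      qed (use \<alpha> in simp)
      then have "0 < pi - \<theta> t" unfolding eq(2) .
      then show "\<theta> t < pi" by simp
      show "\<bar>\<beta> - \<alpha>\<bar> * min t (1 - t) \<le> min (\<theta> t) (pi - \<theta> t)"
      proof (cases "\<alpha> \<le> \<beta>")
        case True
        have "\<bar>\<beta> - \<alpha>\<bar> * min t (1 - t) \<le> (\<beta> - \<alpha>) * t"
          "\<bar>\<beta> - \<alpha>\<bar> * min t (1 - t) \<le> (\<beta> - \<alpha>) * (1 - t)"
          using True t by (auto intro!: mult_mono)
        then show ?thesis using \<alpha> \<beta> by (simp add: \<theta>_def algebra_simps)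
      next
        case False
        have "\<bar>\<beta> - \<alpha>\<bar> * min t (1 - t) \<le> (\<alpha> - \<beta>) * t"
          "\<bar>\<beta> - \<alpha>\<bar> * min t (1 - t) \<le> (\<alpha> - \<beta>) * (1 - t)"
          using False t by (auto intro!: mult_mono)
        then show ?thesis using \<alpha> \<beta> by (simp add: \<theta>_def algebra_simps)
      qed
    qed
    define \<gamma> where "\<gamma> t = half_circle c R (\<theta> t)" for t
    have "dist (\<gamma> r) (\<gamma> r') \<le> R * \<bar>\<beta> - \<alpha>\<bar> * (r' - r)" if "r \<le> r'" for r r'
    proof -
      have "\<theta> r - \<theta> r' = (\<beta> - \<alpha>) * (r - r')" by (simp add: \<theta>_def algebra_simps)
      then have "\<bar>\<theta> r - \<theta> r'\<bar> = \<bar>\<beta> - \<alpha>\<bar> * (r' - r)" using that by (simp add: abs_mult)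
      then show ?thesis
        using dist_half_circle_le[of R c "\<theta> r" "\<theta> r'"] R by (simp add: \<gamma>_def mult.assoc)
    qed
    moreover have "R * \<bar>\<beta> - \<alpha>\<bar> \<le> pi / 2 * dist (\<gamma> 0) (\<gamma> 1)"
    proof -
      have "\<bar>\<beta> - \<alpha>\<bar> / 2 \<le> pi / 2 * sin (\<bar>\<beta> - \<alpha>\<bar> / 2)"
        by (rule sin_Jordan) (use \<alpha> \<beta> in auto)
      also have "\<dots> \<le> pi / 2 * \<bar>sin ((\<alpha> - \<beta>) / 2)\<bar>"
        using sin_minus[of "(\<alpha> - \<beta>) / 2"] by (intro mult_left_mono) (auto simp: abs_if minus_divide_left)
      finally have "2 * R * (\<bar>\<beta> - \<alpha>\<bar> / 2) \<le> 2 * R * (pi / 2 * \<bar>sin ((\<alpha> - \<beta>) / 2)\<bar>)"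
        using R by (intro mult_left_mono) auto
      then show ?thesis using R by (simp add: \<gamma>_def dist_half_circle \<theta>_def mult_ac)
    qed
    moreover have "R * \<bar>\<beta> - \<alpha>\<bar> * min t (1 - t) \<le> pi / 2 * snd (\<gamma> t)" if t: "0 \<le> t" "t \<le> 1" for t
    proof -
      have "\<bar>\<beta> - \<alpha>\<bar> * min t (1 - t) \<le> pi / 2 * sin (\<theta> t)"
        using \<theta>[OF t] min_angle_le[of "\<theta> t"] by linarith
      from mult_left_mono[OF this, of R] show ?thesis
        using R by (simp add: \<gamma>_def half_circle_def mult_ac)
    qed
    moreover have "\<gamma> ` {0..1} \<subseteq> upper_half_plane"
      using \<theta> R by (auto simp: \<gamma>_def intro!: half_circle_in_upper_half_plane)
    ultimately show ?thesis
      using \<alpha> \<beta> by (intro exI[of _ \<gamma>] exI[of _ "R * \<bar>\<beta> - \<alpha>\<bar>"]) (auto simp: \<gamma>_def \<theta>_def)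
  qed
  then obtain \<gamma> K where \<gamma>: "\<gamma> 0 = x" "\<gamma> 1 = y" "\<gamma> ` {0..1} \<subseteq> upper_half_plane"
      "\<And>r r'. 0 \<le> r \<Longrightarrow> r \<le> r' \<Longrightarrow> r' \<le> 1 \<Longrightarrow> dist (\<gamma> r) (\<gamma> r') \<le> K * (r' - r)"
      "K \<le> pi / 2 * dist (\<gamma> 0) (\<gamma> 1)"
      "\<And>t. 0 \<le> t \<Longrightarrow> t \<le> 1 \<Longrightarrow> K * min t (1 - t) \<le> pi / 2 * snd (\<gamma> t)"
    by blast
  show ?thesis
    using half_plane_uniform_curveI[OF \<gamma>(3-6) pi2] \<gamma>(1,2) by blast
qed

lemma half_plane_not_mcomplete: "\<not> H.mcomplete"
proof
  assume c: "H.mcomplete"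
  define \<sigma> :: "nat \<Rightarrow> real \<times> real" where "\<sigma> n = (0, inverse (real (Suc n)))" for n
  have lim: "\<sigma> \<longlonglongrightarrow> (0, 0)"
    unfolding \<sigma>_def by (intro tendsto_Pair tendsto_const LIMSEQ_inverse_real_of_nat)
  then have "H.MCauchy \<sigma>"
    by (auto simp: MCauchy_dist_iff LIMSEQ_imp_Cauchy \<sigma>_def mem_upper_half_plane)
  then obtain p where "limitin (top_of_set upper_half_plane) \<sigma> p sequentially"
    using c by (auto simp: H.mcomplete_def mtopology_dist)
  then have "p \<in> upper_half_plane" "\<sigma> \<longlonglongrightarrow> p" by (auto simp: limitin_subtopology)
  moreover from this(2) have "p = (0, 0)" by (rule LIMSEQ_unique) (rule lim)
  ultimately show False by (simp add: mem_upper_half_plane)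
qed

lemma half_plane_C_uniform: "H.C_uniform (pi / 2)"
  unfolding H.C_uniform_def
proof (intro conjI ballI half_plane_not_mcomplete half_plane_uniform_curve_exists)
  show "1 \<le> pi / 2" using pi_gt3 by simp
  have "open upper_half_plane" unfolding upper_half_plane_def by (intro open_Times) auto
  then show "locally_compact_space H.mtopology"
    unfolding mtopology_dist
    by (intro locally_compact_space_open_subset locally_compact_space_euclidean) auto
qed

section \<open>Distances defined by minimizing line integrals\<close>

text \<open>The infimum that defines the sphericalized distance, kept in the extended nonnegative reals, where
the triangle inequality holds also between points that no rectifiable curve connects.\<close>

definition weighted_dist :: "'a::metric_space set \<Rightarrow> ('a \<Rightarrow> real) \<Rightarrow> 'a \<Rightarrow> 'a \<Rightarrow> ennreal" where
  "weighted_dist M f x y =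
     (INF (s, u, \<gamma>) \<in> {(s, u, \<gamma>). Metric_space.curve M dist s u \<gamma> \<and>
         Metric_space.rectifiable dist s u \<gamma> \<and> \<gamma> s = x \<and> \<gamma> u = y}.
       Metric_space.line_integral dist f s u \<gamma>)"

lemma sphericalized_dist_eq:
  "Metric_space.sphericalized_dist M dist b \<rho> x y = enn2real (weighted_dist M (\<lambda>z. \<rho> (dist b z)) x y)"
  unfolding Metric_space.sphericalized_dist_def[OF Metric_space_dist] weighted_dist_def ..

context
  fixes M :: "'a::metric_space set"
begin

interpretation Metric_space M dist by (rule Metric_space_dist)

lemma weighted_dist_le:
  assumes "curve s u \<gamma>" "rectifiable s u \<gamma>"
  shows "weighted_dist M f (\<gamma> s) (\<gamma> u) \<le> line_integral f s u \<gamma>"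
  unfolding weighted_dist_def by (rule INF_lower2[of "(s, u, \<gamma>)"]) (use assms in auto)

lemma weighted_dist_greatest:
  assumes "\<And>s u \<gamma>. curve s u \<gamma> \<Longrightarrow> rectifiable s u \<gamma> \<Longrightarrow> \<gamma> s = x \<Longrightarrow> \<gamma> u = y \<Longrightarrow> c \<le> line_integral f s u \<gamma>"
  shows "c \<le> weighted_dist M f x y"
  unfolding weighted_dist_def by (rule INF_greatest) (use assms in auto)

lemma weighted_dist_refl:
  assumes "x \<in> M" shows "weighted_dist M f x x = 0"
proof -
  have c: "curve 0 0 (\<lambda>_. x)" "rectifiable 0 0 (\<lambda>_. x)"
    by (rule Lipschitz_curve[of _ _ _ 0]; use assms in simp)+
  have "line_integral f 0 0 (\<lambda>_. x) \<le> ennreal \<bar>f x\<bar> * curve_length 0 0 (\<lambda>_. x)"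
    by (rule line_integral_le[OF c]) auto
  then show ?thesis
    using weighted_dist_le[OF c, of f] assms by (simp add: antisym_conv)
qed

text \<open>The parametrization is Lipschitz and hence continuous, so the integrands of line integrals inherit
  the measurability of the weight.\<close>

lemma arc_length_param_measurable:
  assumes \<gamma>: "curve s u \<gamma>" "rectifiable s u \<gamma>" and f: "f \<in> borel_measurable (restrict_space borel M)"
  shows "(\<lambda>r. f (arc_length_param s u \<gamma> r))
      \<in> borel_measurable (restrict_space borel {0..enn2real (curve_length s u \<gamma>)})"
proof -
  let ?I = "{0..enn2real (curve_length s u \<gamma>)}"
  have lip: "dist (arc_length_param s u \<gamma> r) (arc_length_param s u \<gamma> r') \<le> dist r r'"
    if "r \<in> ?I" "r' \<in> ?I" for r r'
    using arc_length_param_1Lipschitz[OF \<gamma>, of r r'] arc_length_param_1Lipschitz[OF \<gamma>, of r' r] that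
    by (cases "r \<le> r'") (auto simp: dist_real_def dist_commute)
  have "continuous_on ?I (arc_length_param s u \<gamma>)"
    unfolding continuous_on_iff by (meson lip le_less_trans)
  then have "arc_length_param s u \<gamma> \<in> borel_measurable (restrict_space borel ?I)"
    by (rule borel_measurable_continuous_on_restrict)
  moreover have "arc_length_param s u \<gamma> r \<in> M" if "r \<in> ?I" for r
    using arc_length_paramE[OF \<gamma> that] curve_in_M[OF \<gamma>(1)] by metis
  ultimately have "arc_length_param s u \<gamma> \<in> measurable (restrict_space borel ?I) (restrict_space borel M)"
    by (intro measurable_restrict_space2) (auto simp: space_restrict_space)
  from measurable_compose[OF this f] show ?thesis .
qed

lemma weighted_dist_commute:
  assumes f: "f \<in> borel_measurable (restrict_space borel M)"
  shows "weighted_dist M f x y = weighted_dist M f y x"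
proof -
  have "weighted_dist M f x y \<le> weighted_dist M f y x" for x y
  proof (rule weighted_dist_greatest)
    fix s u \<gamma> assume \<gamma>: "curve s u \<gamma>" "rectifiable s u \<gamma>" "\<gamma> s = y" "\<gamma> u = x"
    have "rectifiable (- u) (- s) (\<lambda>t. \<gamma> (- t))"
      using \<gamma>(2) by (simp add: rectifiable_def curve_length_reverse)
    from weighted_dist_le[OF curve_reverse[OF \<gamma>(1)] this, of f]
    show "weighted_dist M f x y \<le> line_integral f s u \<gamma>"
      using \<gamma> line_integral_reverse[OF \<gamma>(1,2) arc_length_param_measurable[OF \<gamma>(1,2) f]] by simp
  qed
  then show ?thesis by (simp add: antisym)
qed

lemma weighted_dist_triangle:
  assumes f: "f \<in> borel_measurable (restrict_space borel M)"
  shows "weighted_dist M f x z \<le> weighted_dist M f x y + weighted_dist M f y z"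
proof -
  let ?P = "\<lambda>x y. {(s, u, \<gamma>). curve s u \<gamma> \<and> rectifiable s u \<gamma> \<and> \<gamma> s = x \<and> \<gamma> u = y}"
  let ?l = "\<lambda>(s, u, \<gamma>). line_integral f s u \<gamma>"
  have join: "weighted_dist M f x z \<le> ?l p + ?l q" if pq: "p \<in> ?P x y" "q \<in> ?P y z" for p q
  proof -
    obtain s u \<gamma> where p: "p = (s, u, \<gamma>)" "curve s u \<gamma>" "rectifiable s u \<gamma>" "\<gamma> s = x" "\<gamma> u = y"
      using pq by auto
    obtain s' u' \<gamma>' where q: "q = (s', u', \<gamma>')" "curve s' u' \<gamma>'" "rectifiable s' u' \<gamma>'" "\<gamma>' s' = y" "\<gamma>' u' = z"
      using pq by auto
    have eq: "\<gamma> u = \<gamma>' s'" using p q by simp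
    let ?j = "join_at u \<gamma> s' \<gamma>'"
    note j = p(2,3) q(2,3) eq
    have "rectifiable s (u + (u' - s')) ?j"
      using curve_length_join[OF j] p q by (simp add: rectifiable_def)
    from weighted_dist_le[OF curve_join[OF j] this, of f]
    have "weighted_dist M f (?j s) (?j (u + (u' - s'))) \<le> line_integral f s u \<gamma> + line_integral f s' u' \<gamma>'"
      using line_integral_join[OF j arc_length_param_measurable[OF p(2,3) f] arc_length_param_measurable[OF q(2,3) f]]
      by (rule order_trans)
    moreover have "?j s = x" "?j (u + (u' - s')) = z"
      using p q eq by (auto simp: join_at_def curve_def)
    ultimately show ?thesis by (simp add: p q)
  qed
  have W: "weighted_dist M f x y = (INF p\<in>?P x y. ?l p)" for x y
    unfolding weighted_dist_def by (simp add: case_prod_unfold)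
  show ?thesis
  proof (rule ennreal_le_epsilon)
    fix e :: real
    assume fin: "weighted_dist M f x y + weighted_dist M f y z < top" and e: "0 < e"
    have "weighted_dist M f x y < weighted_dist M f x y + ennreal (e / 2)"
      "weighted_dist M f y z < weighted_dist M f y z + ennreal (e / 2)"
      using fin e ennreal_add_left_cancel_less[of _ 0 "ennreal (e / 2)"] by auto
    then obtain p q where p: "p \<in> ?P x y" "?l p \<le> weighted_dist M f x y + ennreal (e / 2)"
      and q: "q \<in> ?P y z" "?l q \<le> weighted_dist M f y z + ennreal (e / 2)"
      unfolding W[of x y] W[of y z] INF_less_iff by (meson less_imp_le)
    have "weighted_dist M f x z \<le> (weighted_dist M f x y + ennreal (e / 2)) + (weighted_dist M f y z + ennreal (e / 2))"
      using join[OF p(1) q(1)] add_mono[OF p(2) q(2)] by (rule order_trans)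
    also have "\<dots> = weighted_dist M f x y + weighted_dist M f y z + (ennreal (e / 2) + ennreal (e / 2))"
      by (simp add: ac_simps)
    also have "ennreal (e / 2) + ennreal (e / 2) = ennreal e"
      using e by (simp add: ennreal_plus[symmetric] del: ennreal_plus)
    finally show "weighted_dist M f x z \<le> weighted_dist M f x y + weighted_dist M f y z + ennreal e" .
  qed
qed

end

section \<open>Tails of a density\<close>

text \<open>The constants \<open>C\<close> and \<open>B\<close> are parameters, since the choice of the radii below depends on them.\<close>

locale bounded_quasidecreasing_density =
  fixes \<rho> :: "real \<Rightarrow> real" and C B :: real
  assumes meas: "\<rho> \<in> borel_measurable (restrict_space borel {0<..})"
    and pos: "t > 0 \<Longrightarrow> \<rho> t > 0"
    and finite_integral: "(\<integral>\<^sup>+ t \<in> {0<..}. ennreal (\<rho> t) \<partial>lborel) < \<infinity>"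
    and bound: "t > 0 \<Longrightarrow> \<rho> t \<le> B"
    and C_ge_1: "C \<ge> 1"
    and quasidecr: "0 < s \<Longrightarrow> s \<le> t \<Longrightarrow> \<rho> t \<le> C * \<rho> s"
begin

text \<open>The function called \<open>F\<close> in the introduction.\<close>

definition tail :: "real \<Rightarrow> real" where
  "tail r = (LBINT t:{r<..}. \<rho> t)"

lemma set_integrable_density:
  assumes "A \<in> sets borel" "A \<subseteq> {0<..}"
  shows "set_integrable lborel A \<rho>"
proof -
  have "set_integrable lborel {0<..} \<rho>"
    unfolding set_integrable_def
  proof (rule integrableI_nonneg)
    show "(\<lambda>t. indicator {0<..} t *\<^sub>R \<rho> t) \<in> borel_measurable lborel"
      using meas by (subst (asm) borel_measurable_restrict_space_iff) auto
    show "AE t in lborel. 0 \<le> indicator {0<..} t *\<^sub>R \<rho> t"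
      using pos by (auto simp: indicator_def less_imp_le)
    have "(\<integral>\<^sup>+ t. ennreal (indicator {0<..} t *\<^sub>R \<rho> t) \<partial>lborel) = (\<integral>\<^sup>+ t \<in> {0<..}. ennreal (\<rho> t) \<partial>lborel)"
      by (intro nn_integral_cong) (auto simp: indicator_def)
    then show "(\<integral>\<^sup>+ t. ennreal (indicator {0<..} t *\<^sub>R \<rho> t) \<partial>lborel) < \<infinity>"
      using finite_integral by simp
  qed
  then show ?thesis by (rule set_integrable_subset) (use assms in auto)
qed

lemma tail_diff:
  assumes "0 < a" "a \<le> b"
  shows "tail a - tail b = (LBINT t:{a<..b}. \<rho> t)"
proof -
  have "{a<..} = {a<..b} \<union> {b<..}" using assms by auto
  then have "tail a = (LBINT t:{a<..b} \<union> {b<..}. \<rho> t)" by (simp add: tail_def)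
  also have "\<dots> = (LBINT t:{a<..b}. \<rho> t) + tail b"
    unfolding tail_def using assms by (intro set_integral_Un set_integrable_density) auto
  finally show ?thesis by simp
qed

lemma LBINT_const_Ioc: "a \<le> b \<Longrightarrow> (LBINT t:{a<..b}. c) = c * (b - a)" for a b c :: real
  by (simp add: set_lebesgue_integral_def)

lemma set_integrable_const_Ioc: "set_integrable lborel {a<..b} (\<lambda>_. c)" for a b c :: real
  unfolding set_integrable_def by (cases "a \<le> b") (auto intro!: integrable_real_indicator)

text \<open>On \<open>{a<..b}\<close> a quasidecreasing density is at least \<open>\<rho> b / C\<close>.\<close>

lemma tail_diff_ge:
  assumes "0 < a" "a \<le> b"
  shows "(b - a) * \<rho> b \<le> C * (tail a - tail b)"
proof -
  have "\<rho> b / C * (b - a) = (LBINT t:{a<..b}. \<rho> b / C)"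
    using assms by (simp add: LBINT_const_Ioc)
  also have "\<dots> \<le> (LBINT t:{a<..b}. \<rho> t)"
  proof (rule set_integral_mono)
    fix t assume "t \<in> {a<..b}"
    then show "\<rho> b / C \<le> \<rho> t"
      using quasidecr[of t b] assms C_ge_1 by (simp add: divide_le_eq mult.commute)
  qed (use assms in \<open>auto intro!: set_integrable_density set_integrable_const_Ioc\<close>)
  finally show ?thesis
    using C_ge_1 by (simp add: tail_diff[OF assms] divide_le_eq mult_ac)
qed

text \<open>The bound \<open>B\<close> on \<open>\<rho>\<close> is a Lipschitz constant of \<open>tail\<close>, which is therefore continuous.\<close>

lemma tail_diff_le:
  assumes "0 < a" "a \<le> b"
  shows "tail a - tail b \<le> B * (b - a)"
  unfolding tail_diff[OF assms] LBINT_const_Ioc[OF assms(2), symmetric]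
  by (rule set_integral_mono)
     (use assms bound in \<open>auto intro!: set_integrable_density set_integrable_const_Ioc\<close>)

lemma tail_strict_antimono: "0 < a \<Longrightarrow> a < b \<Longrightarrow> tail b < tail a"
  using tail_diff_ge[of a b] pos[of b] C_ge_1 mult_pos_pos[of "b - a" "\<rho> b"]
  by (smt (verit) mult_le_0_iff)

lemma tail_antimono: "0 < a \<Longrightarrow> a \<le> b \<Longrightarrow> tail b \<le> tail a"
  using tail_strict_antimono[of a b] by (cases "a = b") auto

lemma tail_nonneg: "0 \<le> a \<Longrightarrow> 0 \<le> tail a"
  unfolding tail_def set_lebesgue_integral_def
  by (rule Bochner_Integration.integral_nonneg) (auto simp: indicator_def less_imp_le pos)

lemma tail_pos: "0 < a \<Longrightarrow> 0 < tail a"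
  using tail_strict_antimono[of a "a + 1"] tail_nonneg[of "a + 1"] by auto

lemma tail_continuous: "continuous_on {0<..} tail"
proof (rule continuous_on_iff[THEN iffD2], intro ballI allI impI)
  fix a e :: real assume a: "a \<in> {0<..}" and e: "0 < e"
  have B: "0 < B" using bound[of 1] pos[of 1] by simp
  have "dist (tail a') (tail a) < e" if "a' \<in> {0<..}" "dist a' a < e / B" for a'
  proof -
    have "dist (tail a') (tail a) \<le> B * dist a' a"
      using tail_diff_le[of a a'] tail_diff_le[of a' a] tail_antimono[of a a'] tail_antimono[of a' a] a that
      by (cases "a \<le> a'") (auto simp: dist_real_def)
    also have "\<dots> < e" using that B by (simp add: field_simps)
    finally show ?thesis .
  qed
  then show "\<exists>d>0. \<forall>a'\<in>{0<..}. dist a' a < d \<longrightarrow> dist (tail a') (tail a) < e"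
    using e B by (intro exI[of _ "e / B"]) auto
qed

lemma tail_tendsto_0: "(tail \<longlongrightarrow> 0) at_top"
proof -
  let ?g = "\<lambda>t. indicator {0<..} t *\<^sub>R \<rho> t"
  have int: "integrable lborel ?g"
    using set_integrable_density[of "{0<..}"] by (simp add: set_integrable_def)
  have "((\<lambda>r. \<integral>t. indicator {r<..} t *\<^sub>R ?g t \<partial>lborel) \<longlongrightarrow> (\<integral>t. 0 \<partial>(lborel :: real measure))) at_top"
  proof (rule integral_dominated_convergence_at_top[where w = ?g])
    show "integrable lborel ?g" by (rule int)
    show "(\<lambda>t. indicator {r<..} t *\<^sub>R ?g t) \<in> borel_measurable lborel" for r
      using borel_measurable_integrable[OF int] by measurable
    show "\<forall>\<^sub>F r in at_top. AE t in lborel. norm (indicator {r<..} t *\<^sub>R ?g t) \<le> ?g t"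
      by (rule always_eventually) (auto simp: indicator_def less_imp_le pos)
    show "AE t in lborel. ((\<lambda>r. indicator {r<..} t *\<^sub>R ?g t) \<longlongrightarrow> 0) at_top"
    proof (rule AE_I2)
      fix t :: real
      have "\<forall>\<^sub>F r in at_top. indicator {r<..} t *\<^sub>R ?g t = 0"
        using eventually_ge_at_top[of t] by eventually_elim (auto simp: indicator_def)
      then show "((\<lambda>r. indicator {r<..} t *\<^sub>R ?g t) \<longlongrightarrow> 0) at_top"
        by (rule tendsto_eventually)
    qed
  qed auto
  moreover have "\<forall>\<^sub>F r in at_top. (\<integral>t. indicator {r<..} t *\<^sub>R ?g t \<partial>lborel) = tail r"
    using eventually_ge_at_top[of 0]
  proof eventually_elim
    case (elim r)
    then show ?case unfolding tail_def set_lebesgue_integral_def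
      by (intro Bochner_Integration.integral_cong) (auto simp: indicator_def)
  qed
  ultimately have "(tail \<longlongrightarrow> (\<integral>t. 0 \<partial>(lborel :: real measure))) at_top"
    by (rule Lim_transform_eventually)
  then show ?thesis by simp
qed

text \<open>By \<open>tail_diff_ge\<close> on the interval from \<open>r / 2\<close> to \<open>r\<close>, \<open>r * \<rho> r\<close> is at most \<open>2 * C * tail (r / 2)\<close>. Hence
large circles become short in the sphericalized metric.\<close>

lemma radius_density_tendsto_0: "((\<lambda>r. r * \<rho> r) \<longlongrightarrow> 0) at_top"
proof (rule tendsto_sandwich)
  show "\<forall>\<^sub>F r in at_top. 0 \<le> r * \<rho> r"
    using eventually_gt_at_top[of 0] by eventually_elim (simp add: pos less_imp_le)
  show "\<forall>\<^sub>F r in at_top. r * \<rho> r \<le> 2 * C * tail (r / 2)"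
    using eventually_gt_at_top[of 0]
  proof eventually_elim
    case (elim r)
    have "C * (tail (r / 2) - tail r) \<le> C * tail (r / 2)"
      using C_ge_1 tail_nonneg[of r] elim by (intro mult_left_mono) auto
    then show ?case using tail_diff_ge[of "r / 2" r] elim by (simp add: field_simps)
  qed
  have "filterlim (\<lambda>r::real. r / 2) at_top at_top"
    using filterlim_tendsto_pos_mult_at_top[OF tendsto_const[of "1 / 2"] _ filterlim_ident] by simp
  from filterlim_compose[OF tail_tendsto_0 this]
  show "((\<lambda>r. 2 * C * tail (r / 2)) \<longlongrightarrow> 0) at_top" by (intro tendsto_mult_right_zero)
qed simp

lemma nn_integral_Ioc:
  assumes "0 < a" "a \<le> b"
  shows "(\<integral>\<^sup>+ t \<in> {a<..b}. ennreal (\<rho> t) \<partial>lborel) = ennreal (tail a - tail b)"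
proof -
  have int: "integrable lborel (\<lambda>t. indicator {a<..b} t *\<^sub>R \<rho> t)"
    unfolding set_integrable_def[symmetric] by (rule set_integrable_density) (use assms in auto)
  have "(\<integral>\<^sup>+ t \<in> {a<..b}. ennreal (\<rho> t) \<partial>lborel) = (\<integral>\<^sup>+ t. ennreal (indicator {a<..b} t *\<^sub>R \<rho> t) \<partial>lborel)"
    by (intro nn_integral_cong) (auto simp: indicator_def)
  also have "\<dots> = ennreal (tail a - tail b)"
    unfolding tail_diff[OF assms] set_lebesgue_integral_def
    by (rule nn_integral_eq_integral[OF int]) (use assms pos in \<open>auto simp: indicator_def less_imp_le\<close>)
  finally show ?thesis .
qed

lemma nn_integral_shifted:
  assumes "0 < a" "0 \<le> l"
  shows "(\<integral>\<^sup>+ r \<in> {0..l}. ennreal (\<rho> (a + r)) \<partial>lborel) = ennreal (tail a - tail (a + l))"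
proof -
  define h where "h t = ennreal (\<rho> t) * indicator {a<..a + l} t" for t
  have "\<rho> \<in> borel_measurable (restrict_space borel {a<..a + l})"
    by (rule measurable_restrict_mono[OF meas]) (use assms in auto)
  then have [measurable]: "h \<in> borel_measurable borel"
    unfolding h_def by (subst borel_measurable_restrict_space_iff_ennreal[symmetric]) auto
  have "(\<integral>\<^sup>+ r \<in> {0..l}. ennreal (\<rho> (a + r)) \<partial>lborel) = (\<integral>\<^sup>+ r. h (a + 1 * r) \<partial>lborel)"
  proof (rule nn_integral_cong_AE)
    show "AE r in lborel. ennreal (\<rho> (a + r)) * indicator {0..l} r = h (a + 1 * r)"
      using AE_lborel_singleton[of 0] by eventually_elim (auto simp: h_def indicator_def)
  qed
  also have "\<dots> = (\<integral>\<^sup>+ t. h t \<partial>lborel)" using nn_integral_real_affine[of h 1 a] by simp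
  also have "\<dots> = ennreal (tail a - tail (a + l))"
    unfolding h_def using nn_integral_Ioc[of a "a + l"] assms by simp
  finally show ?thesis .
qed

end


section \<open>The sphericalized metric of the half-plane\<close>

lemma dist_origin: "dist (0, 0) z = norm (z :: real \<times> real)"
  by (simp flip: zero_prod_def)

lemma norm_upper_half_plane_pos: "z \<in> upper_half_plane \<Longrightarrow> 0 < norm z"
  by (auto simp: mem_upper_half_plane zero_prod_def)

lemma scaleR_upper_half_plane: "z \<in> upper_half_plane \<Longrightarrow> 0 < c \<Longrightarrow> c *\<^sub>R z \<in> upper_half_plane"
  by (simp add: mem_upper_half_plane)

context bounded_quasidecreasing_density
begin

abbreviation W :: "real \<times> real \<Rightarrow> real \<times> real \<Rightarrow> ennreal" where
  "W \<equiv> weighted_dist upper_half_plane (\<lambda>z. \<rho> (dist (0, 0) z))"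

abbreviation d\<^sub>\<rho> :: "real \<times> real \<Rightarrow> real \<times> real \<Rightarrow> real" where
  "d\<^sub>\<rho> \<equiv> H.sphericalized_dist (0, 0) \<rho>"

lemma weight_measurable: "(\<lambda>z. \<rho> (dist (0, 0) z)) \<in> borel_measurable (restrict_space borel upper_half_plane)"
proof -
  have "(\<lambda>z::real\<times>real. norm z) \<in> measurable (restrict_space borel upper_half_plane) (restrict_space borel {0<..})"
    using norm_upper_half_plane_pos
    by (intro measurable_restrict_space3) auto
  from measurable_compose[OF this meas] show ?thesis by (simp add: dist_origin)
qed

text \<open>Segments are rectifiable, and a bounded weight has finite integrals over them.\<close>

lemma W_finite:
  assumes x: "x \<in> upper_half_plane" and y: "y \<in> upper_half_plane"
  shows "W x y < \<infinity>"
proof -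
  define \<gamma> where "\<gamma> t = (1 - t) *\<^sub>R x + t *\<^sub>R y" for t
  have "snd (\<gamma> t) > 0" if "0 \<le> t" "t \<le> 1" for t
    using that x y by (cases "t = 0") (auto simp: \<gamma>_def mem_upper_half_plane intro!: add_nonneg_pos)
  then have im: "\<gamma> ` {0..1} \<subseteq> upper_half_plane" by (auto simp: mem_upper_half_plane)
  have lip: "dist (\<gamma> r) (\<gamma> r') \<le> dist x y * (r' - r)" if "r \<le> r'" for r r'
  proof -
    have "\<gamma> r - \<gamma> r' = (r' - r) *\<^sub>R (x - y)" by (simp add: \<gamma>_def algebra_simps)
    then show ?thesis using that by (simp add: dist_norm)
  qed
  have c: "H.curve 0 1 \<gamma>" "H.rectifiable 0 1 \<gamma>"
    by (rule H.Lipschitz_curve[OF _ im, of "dist x y"]; use lip in simp)+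
  have "W (\<gamma> 0) (\<gamma> 1) \<le> H.line_integral (\<lambda>z. \<rho> (dist (0, 0) z)) 0 1 \<gamma>"
    by (rule weighted_dist_le[OF c])
  also have "\<dots> \<le> ennreal B * H.curve_length 0 1 \<gamma>"
  proof (rule H.line_integral_le[OF c])
    show "\<rho> (dist (0, 0) (\<gamma> t)) \<le> B" if "t \<in> {0..1}" for t
      unfolding dist_origin using that im by (intro bound norm_upper_half_plane_pos) auto
    show "0 \<le> B" using bound[of 1] pos[of 1] by simp
  qed
  also have "\<dots> < \<infinity>" using c(2) by (simp add: H.rectifiable_def ennreal_mult_less_top)
  finally show ?thesis by (simp add: \<gamma>_def)
qed

text \<open>A radial segment is parametrized by the distance to the origin, so its line integral is the integral of
\<open>\<rho>\<close> over the interval of radii.\<close>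

lemma W_radial_le:
  assumes z: "z \<in> upper_half_plane" and R: "norm z \<le> R"
  shows "W z ((R / norm z) *\<^sub>R z) \<le> ennreal (tail (norm z))"
proof -
  define a where "a = norm z"
  have a: "0 < a" using norm_upper_half_plane_pos[OF z] by (simp add: a_def)
  define \<gamma> where "\<gamma> t = (t / a) *\<^sub>R z" for t
  have dist: "dist (\<gamma> r) (\<gamma> r') = \<bar>r - r'\<bar>" for r r'
  proof -
    have "\<gamma> r - \<gamma> r' = ((r - r') / a) *\<^sub>R z" by (simp add: \<gamma>_def algebra_simps diff_divide_distrib)
    then show ?thesis using a by (simp add: dist_norm a_def[symmetric])
  qed
  have im: "\<gamma> ` {a..R} \<subseteq> upper_half_plane"
    using z a by (auto simp: \<gamma>_def intro!: scaleR_upper_half_plane)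
  have aR: "a \<le> R" using R by (simp add: a_def)
  have c: "H.curve a R \<gamma>" "H.rectifiable a R \<gamma>"
    by (rule H.Lipschitz_curve[OF aR im, of 1]; use dist in simp)+
  have len: "H.curve_length a t \<gamma> = ennreal (t - a)" if "a \<le> t" for t
  proof (rule antisym)
    show "H.curve_length a t \<gamma> \<le> ennreal (t - a)"
      using H.curve_length_Lipschitz_le[of a t \<gamma> 1] dist by simp
    show "ennreal (t - a) \<le> H.curve_length a t \<gamma>"
      using H.dist_le_curve_length[OF that, of \<gamma>] that by (simp add: dist)
  qed
  have "H.line_integral (\<lambda>z. \<rho> (dist (0, 0) z)) a R \<gamma> = (\<integral>\<^sup>+ r \<in> {0..R - a}. ennreal (\<rho> (a + r)) \<partial>lborel)"
  proof (rule H.line_integral_cong)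
    show "R - a = enn2real (H.curve_length a R \<gamma>)" using len[OF aR] aR by simp
    fix r assume "r \<in> {0..enn2real (H.curve_length a R \<gamma>)}"
    then have r: "0 \<le> r" "r \<le> R - a" using len[OF aR] aR by auto
    then have "H.arc_length_param a R \<gamma> r = \<gamma> (a + r)"
      by (intro H.arc_length_param_eq[OF c]) (auto simp: len)
    moreover have "norm (\<gamma> (a + r)) = a + r" using a r by (simp add: \<gamma>_def a_def[symmetric])
    ultimately show "\<rho> (dist (0, 0) (H.arc_length_param a R \<gamma> r)) = \<rho> (a + r)" by (simp add: dist_origin)
  qed
  also have "\<dots> = ennreal (tail a - tail R)" using nn_integral_shifted[of a "R - a"] a aR by simp
  also have "\<dots> \<le> ennreal (tail a)" using tail_nonneg[of R] a aR by (intro ennreal_leI) auto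
  finally have "W (\<gamma> a) (\<gamma> R) \<le> ennreal (tail a)"
    using weighted_dist_le[OF c, of "\<lambda>z. \<rho> (dist (0, 0) z)"] by (rule order_trans[rotated])
  then show ?thesis using a by (simp add: \<gamma>_def a_def)
qed

lemma norm_half_circle: "R \<ge> 0 \<Longrightarrow> norm (half_circle 0 R \<theta>) = R"
  by (simp add: half_circle_def norm_Pair power_mult_distrib flip: distrib_left)

lemma W_circle_le:
  assumes x: "x \<in> upper_half_plane" and y: "y \<in> upper_half_plane" and R: "norm x = R" "norm y = R"
  shows "W x y \<le> ennreal (pi * (R * \<rho> R))"
proof -
  have R0: "R > 0" using norm_upper_half_plane_pos[OF x] R by simp
  obtain \<alpha> where \<alpha>: "0 < \<alpha>" "\<alpha> < pi" "x = half_circle 0 R \<alpha>"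
    using half_circle_obtain[OF x, of 0] R by (auto simp: dist_origin)
  obtain \<beta> where \<beta>: "0 < \<beta>" "\<beta> < pi" "y = half_circle 0 R \<beta>"
    using half_circle_obtain[OF y, of 0] R by (auto simp: dist_origin)
  have main: "W (half_circle 0 R \<alpha>) (half_circle 0 R \<beta>) \<le> ennreal (pi * (R * \<rho> R))"
    if \<alpha>\<beta>: "0 < \<alpha>" "\<alpha> \<le> \<beta>" "\<beta> < pi" for \<alpha> \<beta>
  proof -
    let ?\<gamma> = "half_circle 0 R"
    have im: "?\<gamma> ` {\<alpha>..\<beta>} \<subseteq> upper_half_plane"
      using \<alpha>\<beta> R0 by (auto intro!: half_circle_in_upper_half_plane)
    have lip: "dist (?\<gamma> r) (?\<gamma> r') \<le> R * (r' - r)" if "r \<le> r'" for r r'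
      using dist_half_circle_le[of R 0 r r'] R0 that by simp
    have c: "H.curve \<alpha> \<beta> ?\<gamma>" "H.rectifiable \<alpha> \<beta> ?\<gamma>"
      by (rule H.Lipschitz_curve[OF \<alpha>\<beta>(2) im, of R]; use lip in simp)+
    have "W (?\<gamma> \<alpha>) (?\<gamma> \<beta>) \<le> H.line_integral (\<lambda>z. \<rho> (dist (0, 0) z)) \<alpha> \<beta> ?\<gamma>"
      by (rule weighted_dist_le[OF c])
    also have "\<dots> \<le> ennreal (\<rho> R) * H.curve_length \<alpha> \<beta> ?\<gamma>"
      by (rule H.line_integral_le[OF c])
         (use R0 pos[OF R0] in \<open>auto simp: dist_origin norm_half_circle\<close>)
    also have "\<dots> \<le> ennreal (\<rho> R) * ennreal (R * (\<beta> - \<alpha>))"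
      by (intro mult_left_mono H.curve_length_Lipschitz_le) (use lip in auto)
    also have "\<dots> = ennreal (\<rho> R * (R * (\<beta> - \<alpha>)))"
      using \<alpha>\<beta> R0 pos[OF R0] by (intro ennreal_mult[symmetric]) auto
    also have "\<dots> \<le> ennreal (pi * (R * \<rho> R))"
    proof (rule ennreal_leI)
      have "(R * \<rho> R) * (\<beta> - \<alpha>) \<le> (R * \<rho> R) * pi"
        using \<alpha>\<beta> R0 pos[OF R0] by (intro mult_left_mono) auto
      then show "\<rho> R * (R * (\<beta> - \<alpha>)) \<le> pi * (R * \<rho> R)" by (simp add: mult_ac)
    qed
    finally show ?thesis .
  qed
  show ?thesis
  proof (cases "\<alpha> \<le> \<beta>")
    case True
    then show ?thesis using main \<alpha> \<beta> by simp
  next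
    case False
    then show ?thesis using main[of \<beta> \<alpha>] \<alpha> \<beta> weighted_dist_commute[OF weight_measurable, of x y] by simp
  qed
qed

text \<open>Radially out to a circle of large radius \<open>R\<close>, along it, and radially back.\<close>

lemma W_le_tails:
  assumes x: "x \<in> upper_half_plane" and y: "y \<in> upper_half_plane"
  shows "W x y \<le> ennreal (tail (norm x) + tail (norm y))"
proof (rule ennreal_le_epsilon)
  fix e :: real assume e: "0 < e"
  have "\<forall>\<^sub>F R in at_top. R * \<rho> R < e / pi"
    using order_tendstoD(2)[OF radius_density_tendsto_0, of "e / pi"] e by simp
  then have "\<forall>\<^sub>F R in at_top. R * \<rho> R < e / pi \<and> norm x \<le> R \<and> norm y \<le> R"
    using eventually_ge_at_top[of "norm x"] eventually_ge_at_top[of "norm y"] by eventually_elim auto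
  then obtain R where R: "R * \<rho> R < e / pi" "norm x \<le> R" "norm y \<le> R"
    unfolding eventually_at_top_linorder by blast
  define x' where "x' = (R / norm x) *\<^sub>R x"
  define y' where "y' = (R / norm y) *\<^sub>R y"
  have nx: "0 < norm x" "0 < norm y" "0 < R"
    using norm_upper_half_plane_pos[OF x] norm_upper_half_plane_pos[OF y] R by linarith+
  have x': "x' \<in> upper_half_plane" "norm x' = R" and y': "y' \<in> upper_half_plane" "norm y' = R"
    using nx x y by (auto simp: x'_def y'_def intro!: scaleR_upper_half_plane)
  note tri = weighted_dist_triangle[OF weight_measurable]
  have "W x y \<le> W x x' + (W x' y' + W y' y)"
    using tri[of x y x'] tri[of x' y y'] by (meson add_left_mono order_trans)
  also have "\<dots> \<le> ennreal (tail (norm x)) + (ennreal e + ennreal (tail (norm y)))"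
  proof (intro add_mono)
    show "W x x' \<le> ennreal (tail (norm x))" unfolding x'_def by (rule W_radial_le[OF x R(2)])
    show "W y' y \<le> ennreal (tail (norm y))"
      unfolding weighted_dist_commute[OF weight_measurable, of y' y] unfolding y'_def by (rule W_radial_le[OF y R(3)])
    have "pi * (R * \<rho> R) \<le> e" using R(1) by (simp add: field_simps)
    then show "W x' y' \<le> ennreal e"
      using W_circle_le[OF x'(1) y'(1) x'(2) y'(2)] by (meson ennreal_leI order_trans)
  qed
  also have "\<dots> = ennreal (tail (norm x) + tail (norm y)) + ennreal e"
    using nx tail_nonneg e by (simp add: ennreal_plus ac_simps)
  finally show "W x y \<le> ennreal (tail (norm x) + tail (norm y)) + ennreal e" .
qed

text \<open>The point \<open>\<alpha> r\<close> that a curve from \<open>x\<close> reaches after arc length \<open>r\<close> satisfies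
\<open>norm (\<alpha> r) \<le> norm x + r\<close>, hence \<open>\<rho> (norm x + r) \<le> C * \<rho> (norm (\<alpha> r))\<close>, and \<open>r\<close> runs at least up to
\<open>dist x y\<close>.\<close>

lemma W_ge:
  assumes x: "x \<in> upper_half_plane" and y: "y \<in> upper_half_plane"
  shows "ennreal ((tail (norm x) - tail (norm x + dist x y)) / C) \<le> W x y"
proof (rule weighted_dist_greatest)
  fix s u \<gamma> assume \<gamma>: "H.curve s u \<gamma>" "H.rectifiable s u \<gamma>" "\<gamma> s = x" "\<gamma> u = y"
  let ?L = "enn2real (H.curve_length s u \<gamma>)"
  let ?I = "H.line_integral (\<lambda>z. \<rho> (dist (0, 0) z)) s u \<gamma>"
  let ?\<alpha> = "H.arc_length_param s u \<gamma>"
  have su: "s \<le> u" using \<gamma>(1) by (simp add: H.curve_def)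
  have L: "dist x y \<le> ?L"
  proof -
    have "ennreal (dist x y) \<le> H.curve_length s u \<gamma>" using H.dist_le_curve_length[OF su, of \<gamma>] \<gamma> by simp
    from enn2real_mono[OF this] show ?thesis using \<gamma>(2) by (simp add: H.rectifiable_def)
  qed
  have a: "0 < norm x" by (rule norm_upper_half_plane_pos[OF x])
  have meas: "(\<lambda>r. \<rho> (dist (0, 0) (?\<alpha> r))) \<in> borel_measurable (restrict_space borel {0..?L})"
    by (rule arc_length_param_measurable[OF \<gamma>(1,2) weight_measurable])
  have "ennreal (tail (norm x) - tail (norm x + dist x y))
      = (\<integral>\<^sup>+ r \<in> {0..dist x y}. ennreal (\<rho> (norm x + r)) \<partial>lborel)"
    using nn_integral_shifted[OF a, of "dist x y"] by simp
  also have "\<dots> \<le> (\<integral>\<^sup>+ r. ennreal C * (ennreal (\<rho> (dist (0, 0) (?\<alpha> r))) * indicator {0..?L} r) \<partial>lborel)"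
  proof (rule nn_integral_mono)
    fix r
    show "ennreal (\<rho> (norm x + r)) * indicator {0..dist x y} r
        \<le> ennreal C * (ennreal (\<rho> (dist (0, 0) (?\<alpha> r))) * indicator {0..?L} r)"
    proof (cases "r \<in> {0..dist x y}")
      case True
      then have r: "r \<in> {0..?L}" using L by auto
      obtain t where "t \<in> {s..u}" "?\<alpha> r = \<gamma> t" by (rule H.arc_length_paramE[OF \<gamma>(1,2) r])
      then have "0 < norm (?\<alpha> r)"
        using H.curve_in_M[OF \<gamma>(1)] norm_upper_half_plane_pos by metis
      moreover have "norm (?\<alpha> r) \<le> norm x + r"
        using H.arc_length_param_1Lipschitz[OF \<gamma>(1,2), of 0 r] H.arc_length_param_start[OF \<gamma>(1,2)] r \<gamma>(3)
          norm_triangle_sub[of "?\<alpha> r" x] by (simp add: dist_norm norm_minus_commute)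
      ultimately have "\<rho> (norm x + r) \<le> C * \<rho> (norm (?\<alpha> r))" by (rule quasidecr)
      then have "ennreal (\<rho> (norm x + r)) \<le> ennreal C * ennreal (\<rho> (norm (?\<alpha> r)))"
        using C_ge_1 pos[OF \<open>0 < norm (?\<alpha> r)\<close>] by (simp add: ennreal_mult[symmetric] ennreal_leI)
      then show ?thesis using True r by (simp add: dist_origin)
    qed simp
  qed
  also have "\<dots> = ennreal C * ?I"
    unfolding H.line_integral_def using meas
    by (intro nn_integral_cmult)
       (simp, subst borel_measurable_restrict_space_iff_ennreal[symmetric], auto)
  finally have le: "ennreal (tail (norm x) - tail (norm x + dist x y)) \<le> ennreal C * ?I" .
  show "ennreal ((tail (norm x) - tail (norm x + dist x y)) / C) \<le> ?I"
  proof (cases "?I")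
    case (real l)
    then show ?thesis using le C_ge_1
      by (auto simp: ennreal_mult[symmetric] ennreal_le_iff pos_divide_le_eq mult.commute intro!: ennreal_leI)
  next
    case top
    then show ?thesis by simp
  qed
qed

lemma d_eq_W: "x \<in> upper_half_plane \<Longrightarrow> y \<in> upper_half_plane \<Longrightarrow> ennreal (d\<^sub>\<rho> x y) = W x y"
  using W_finite[of x y] by (simp add: sphericalized_dist_eq)

lemma d_le_tails:
  assumes "x \<in> upper_half_plane" "y \<in> upper_half_plane"
  shows "d\<^sub>\<rho> x y \<le> tail (norm x) + tail (norm y)"
  using W_le_tails[OF assms] tail_nonneg[of "norm x"] tail_nonneg[of "norm y"]
  by (simp add: d_eq_W[OF assms, symmetric] ennreal_le_iff del: ennreal_plus)

lemma d_ge: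
  assumes "x \<in> upper_half_plane" "y \<in> upper_half_plane"
  shows "tail (norm x) - tail (norm x + dist x y) \<le> C * d\<^sub>\<rho> x y"
proof -
  have "0 \<le> d\<^sub>\<rho> x y" by (simp add: sphericalized_dist_eq)
  then have "(tail (norm x) - tail (norm x + dist x y)) / C \<le> d\<^sub>\<rho> x y"
    using W_ge[OF assms] by (simp add: d_eq_W[OF assms, symmetric] ennreal_le_iff)
  then show ?thesis using C_ge_1 by (simp add: divide_le_eq mult.commute)
qed

text \<open>Distinct points have positive distance because \<open>tail\<close> is strictly decreasing in \<open>d_ge\<close>.\<close>

lemma Metric_space_sphericalized: "Metric_space upper_half_plane d\<^sub>\<rho>"
proof
  fix x y :: "real \<times> real"
  show "0 \<le> d\<^sub>\<rho> x y" by (simp add: sphericalized_dist_eq)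
  show "d\<^sub>\<rho> x y = d\<^sub>\<rho> y x"
    by (simp add: sphericalized_dist_eq weighted_dist_commute[OF weight_measurable, of x y])
next
  fix x y assume xy: "x \<in> upper_half_plane" "y \<in> upper_half_plane"
  show "d\<^sub>\<rho> x y = 0 \<longleftrightarrow> x = y"
  proof
    assume "d\<^sub>\<rho> x y = 0"
    then have "tail (norm x) \<le> tail (norm x + dist x y)" using d_ge[OF xy] by simp
    then show "x = y"
      using tail_strict_antimono[of "norm x" "norm x + dist x y"] norm_upper_half_plane_pos[OF xy(1)]
      by (cases "x = y") auto
  next
    assume "x = y"
    then show "d\<^sub>\<rho> x y = 0" using xy by (simp add: sphericalized_dist_eq weighted_dist_refl)
  qed
next
  fix x y z assume xyz: "x \<in> upper_half_plane" "y \<in> upper_half_plane" "z \<in> upper_half_plane"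
  have "ennreal (d\<^sub>\<rho> x z) \<le> ennreal (d\<^sub>\<rho> x y) + ennreal (d\<^sub>\<rho> y z)"
    using weighted_dist_triangle[OF weight_measurable, of x z y] xyz by (simp add: d_eq_W)
  also have "\<dots> = ennreal (d\<^sub>\<rho> x y + d\<^sub>\<rho> y z)" by (simp add: sphericalized_dist_eq)
  finally show "d\<^sub>\<rho> x z \<le> d\<^sub>\<rho> x y + d\<^sub>\<rho> y z"
    by (subst (asm) ennreal_le_iff) (auto simp: sphericalized_dist_eq)
qed

end

section \<open>The sphericalized half-plane is not uniform\<close>

lemma dist_le_sum_dist: "dist (f 0) (f n) \<le> (\<Sum>i<n. dist (f i) (f (Suc i)))"
proof (induction n)
  case (Suc n)
  then show ?case using dist_triangle[of "f 0" "f (Suc n)" "f n"] by simp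
qed simp

context bounded_quasidecreasing_density
begin

interpretation R: Metric_space upper_half_plane d\<^sub>\<rho>
  by (rule Metric_space_sphericalized)

text \<open>The point at infinity is the class of the sequence \<open>(0, n + 1)\<close>. By \<open>d_le_tails\<close> it is Cauchy and its
distances to \<open>z\<close> are bounded by \<open>tail (norm z)\<close> in the limit; by \<open>d_ge\<close> it stays away from each point \<open>p\<close> of
the half-plane, since \<open>dist p (0, n + 1)\<close> is eventually at least \<open>1\<close>.\<close>

lemma infinity_in_boundary:
  "\<exists>\<omega>\<in>R.metric_boundary. \<forall>z\<in>upper_half_plane. R.completion_dist (R.completion_embed z) \<omega> \<le> tail (norm z)"
proof -
  define \<sigma> :: "nat \<Rightarrow> real \<times> real" where "\<sigma> n = (0, real (Suc n))" for n
  have \<sigma>: "\<sigma> n \<in> upper_half_plane" "norm (\<sigma> n) = real (Suc n)" for n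
    by (auto simp: \<sigma>_def mem_upper_half_plane norm_Pair)
  have lim: "(\<lambda>n. tail (real (Suc n))) \<longlonglongrightarrow> 0"
    by (rule filterlim_compose[OF tail_tendsto_0])
       (rule filterlim_compose[OF filterlim_real_sequentially filterlim_Suc])
  have C: "R.MCauchy \<sigma>"
    unfolding R.MCauchy_def
  proof (intro conjI allI impI)
    show "range \<sigma> \<subseteq> upper_half_plane" using \<sigma> by auto
    fix e :: real assume "0 < e"
    then have "\<forall>\<^sub>F n in sequentially. tail (real (Suc n)) < e / 2"
      using order_tendstoD(2)[OF lim, of "e / 2"] by simp
    then obtain N where N: "\<And>n. N \<le> n \<Longrightarrow> tail (real (Suc n)) < e / 2"
      unfolding eventually_sequentially by blast
    have "d\<^sub>\<rho> (\<sigma> n) (\<sigma> n') < e" if "N \<le> n" "N \<le> n'" for n n'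
      using d_le_tails[OF \<sigma>(1)[of n] \<sigma>(1)[of n']] N[OF that(1)] N[OF that(2)] unfolding \<sigma>(2) by linarith
    then show "\<exists>N. \<forall>n n'. N \<le> n \<longrightarrow> N \<le> n' \<longrightarrow> d\<^sub>\<rho> (\<sigma> n) (\<sigma> n') < e" by blast
  qed
  define \<omega> where "\<omega> = R.Cauchy_rel `` {\<sigma>}"
  have \<sigma>\<omega>: "\<sigma> \<in> \<omega>" using C by (simp add: \<omega>_def R.Cauchy_rel_def R.MCauchy_def image_subset_iff)
  have \<omega>: "\<omega> \<in> R.completion" unfolding R.completion_def \<omega>_def by (rule quotientI) (simp add: C)
  have const: "(\<lambda>_. z) \<in> R.completion_embed z" if "z \<in> upper_half_plane" for z
    using that by (simp add: R.completion_embed_def R.Cauchy_rel_def)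
  have cd: "(\<lambda>n. d\<^sub>\<rho> z (\<sigma> n)) \<longlonglongrightarrow> R.completion_dist (R.completion_embed z) \<omega>"
    if "z \<in> upper_half_plane" for z
    by (rule R.completion_dist_lim[OF R.completion_embed_in[OF that] \<omega> const[OF that] \<sigma>\<omega>])
  have "\<omega> \<noteq> R.completion_embed p" if p: "p \<in> upper_half_plane" for p
  proof
    assume "\<omega> = R.completion_embed p"
    then have "R.completion_dist (R.completion_embed p) \<omega> = 0"
      using R.completion_dist_embed[OF p p] p by simp
    then have 0: "(\<lambda>n. C * d\<^sub>\<rho> p (\<sigma> n)) \<longlonglongrightarrow> 0" using tendsto_mult_right_zero[of _ _ C] cd[OF p] by simp
    have np: "0 < norm p" by (rule norm_upper_half_plane_pos[OF p])
    have "tail (norm p) - tail (norm p + 1) \<le> C * d\<^sub>\<rho> p (\<sigma> n)" if n: "norm p \<le> real n" for n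
    proof -
      have "1 \<le> dist p (\<sigma> n)"
        using norm_triangle_ineq2[of "\<sigma> n" p] n \<sigma>(2)[of n] by (simp add: dist_norm norm_minus_commute)
      then have "tail (norm p + dist p (\<sigma> n)) \<le> tail (norm p + 1)"
        by (intro tail_antimono add_pos_pos np add_left_mono) auto
      then show ?thesis using d_ge[OF p \<sigma>(1)[of n]] by simp
    qed
    then have "\<exists>N. \<forall>n\<ge>N. tail (norm p) - tail (norm p + 1) \<le> C * d\<^sub>\<rho> p (\<sigma> n)"
      by (intro exI[of _ "nat \<lceil>norm p\<rceil>"]) (auto simp: nat_le_iff ceiling_le_iff)
    from LIMSEQ_le_const[OF 0 this] show False
      using tail_strict_antimono[OF np, of "norm p + 1"] by simp
  qed
  then have "\<omega> \<in> R.metric_boundary" using \<omega> by (auto simp: R.metric_boundary_def)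
  moreover have "R.completion_dist (R.completion_embed z) \<omega> \<le> tail (norm z)" if z: "z \<in> upper_half_plane" for z
  proof (rule LIMSEQ_le[OF cd[OF z]])
    show "(\<lambda>n. tail (norm z) + tail (real (Suc n))) \<longlonglongrightarrow> tail (norm z)"
      using tendsto_add[OF tendsto_const lim, of "tail (norm z)"] by simp
    show "\<exists>N. \<forall>n\<ge>N. d\<^sub>\<rho> z (\<sigma> n) \<le> tail (norm z) + tail (real (Suc n))"
      using d_le_tails[OF z \<sigma>(1)] unfolding \<sigma>(2) by blast
  qed
  ultimately show ?thesis by blast
qed

text \<open>By \<open>d_ge\<close>, a point at Euclidean distance at least \<open>e\<close> from \<open>x\<close> has a \<open>d\<^sub>\<rho>\<close>-distance from \<open>x\<close> that is bounded
below by a positive number depending on \<open>x\<close> and \<open>e\<close> only.\<close>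

lemma sphericalized_curve_continuous:
  assumes \<gamma>: "R.curve s u \<gamma>"
  shows "continuous_on {s..u} \<gamma>"
  unfolding continuous_on_iff
proof (intro ballI allI impI)
  fix t e assume t: "t \<in> {s..u}" and e: "0 < (e::real)"
  have M: "\<gamma> r \<in> upper_half_plane" if "r \<in> {s..u}" for r using R.curve_in_M[OF \<gamma> that] .
  define k where "k = (tail (norm (\<gamma> t)) - tail (norm (\<gamma> t) + e)) / C"
  have np: "0 < norm (\<gamma> t)" by (rule norm_upper_half_plane_pos[OF M[OF t]])
  have "0 < k" using tail_strict_antimono[OF np, of "norm (\<gamma> t) + e"] e C_ge_1 by (simp add: k_def)
  then obtain \<delta> where \<delta>: "\<delta> > 0" "\<And>t'. t' \<in> {s..u} \<Longrightarrow> \<bar>t' - t\<bar> < \<delta> \<Longrightarrow> d\<^sub>\<rho> (\<gamma> t) (\<gamma> t') < k"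
    using \<gamma> t unfolding R.curve_iff by meson
  have "dist (\<gamma> t') (\<gamma> t) < e" if t': "t' \<in> {s..u}" "dist t' t < \<delta>" for t'
  proof (rule ccontr)
    assume "\<not> ?thesis"
    then have "tail (norm (\<gamma> t) + dist (\<gamma> t) (\<gamma> t')) \<le> tail (norm (\<gamma> t) + e)"
      using e by (intro tail_antimono add_pos_pos np add_left_mono) (auto simp: dist_commute)
    then have "C * k \<le> C * d\<^sub>\<rho> (\<gamma> t) (\<gamma> t')"
      using d_ge[OF M[OF t] M[OF t'(1)]] C_ge_1 by (simp add: k_def)
    then show False using \<delta>(2)[of t'] t' C_ge_1 by (simp add: dist_real_def)
  qed
  then show "\<exists>\<delta>>0. \<forall>t'\<in>{s..u}. dist t' t < \<delta> \<longrightarrow> dist (\<gamma> t') (\<gamma> t) < e" using \<delta>(1) by blast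
qed

text \<open>A fine partition is needed because \<open>d\<^sub>\<rho>\<close> itself may be much smaller than \<open>\<rho> r\<close> times the Euclidean
distance: short connections may leave the disc of radius \<open>r\<close>. By compactness the curve keeps a positive
distance \<open>\<eta>\<close> from the circle of radius \<open>r\<close>, so for steps shorter than \<open>\<eta>\<close> the radius
\<open>norm x + dist x y\<close> in \<open>d_ge\<close> is at most \<open>r\<close>. One factor \<open>C\<close> is lost in each of \<open>d_ge\<close>, \<open>tail_diff_ge\<close> and the comparison with \<open>\<rho> r\<close>.\<close>

lemma sphericalized_length_ge:
  assumes \<gamma>: "R.curve s u \<gamma>" and inside: "\<And>t. t \<in> {s..u} \<Longrightarrow> norm (\<gamma> t) < r"
  shows "ennreal (\<rho> r / C ^ 3 * dist (\<gamma> s) (\<gamma> u)) \<le> R.curve_length s u \<gamma>"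
proof -
  have su: "s \<le> u" using \<gamma> by (simp add: R.curve_def)
  have M: "\<gamma> t \<in> upper_half_plane" if "t \<in> {s..u}" for t using R.curve_in_M[OF \<gamma> that] .
  have cont: "continuous_on {s..u} \<gamma>" by (rule sphericalized_curve_continuous[OF \<gamma>])
  obtain t0 where t0: "t0 \<in> {s..u}" "\<And>t. t \<in> {s..u} \<Longrightarrow> norm (\<gamma> t) \<le> norm (\<gamma> t0)"
    using continuous_attains_sup[of "{s..u}" "\<lambda>t. norm (\<gamma> t)"] su cont
    by (metis atLeastatMost_empty_iff2 compact_Icc continuous_on_norm not_le)
  define \<eta> where "\<eta> = r - norm (\<gamma> t0)"
  have \<eta>: "\<eta> > 0" using inside[OF t0(1)] by (simp add: \<eta>_def)
  have "uniformly_continuous_on {s..u} \<gamma>"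
    by (rule compact_uniformly_continuous[OF cont compact_Icc])
  then obtain \<delta> where \<delta>: "\<delta> > 0"
    "\<And>t t'. t \<in> {s..u} \<Longrightarrow> t' \<in> {s..u} \<Longrightarrow> dist t' t < \<delta> \<Longrightarrow> dist (\<gamma> t') (\<gamma> t) < \<eta>"
    using \<eta> unfolding uniformly_continuous_on_def by meson
  have step: "\<rho> r / C ^ 3 * dist (\<gamma> t) (\<gamma> t') \<le> d\<^sub>\<rho> (\<gamma> t) (\<gamma> t')"
    if t: "t \<in> {s..u}" "t' \<in> {s..u}" "dist t' t < \<delta>" for t t'
  proof -
    let ?a = "norm (\<gamma> t)"
    let ?D = "dist (\<gamma> t) (\<gamma> t')"
    have a: "0 < ?a" by (rule norm_upper_half_plane_pos[OF M[OF t(1)]])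
    have le: "?a + ?D \<le> r" using \<delta>(2)[OF t] t0(2)[OF t(1)] by (simp add: \<eta>_def dist_commute)
    have "?D * \<rho> r \<le> ?D * (C * \<rho> (?a + ?D))"
      using a le by (intro mult_left_mono quasidecr) (auto intro: add_pos_nonneg)
    also have "\<dots> = C * (((?a + ?D) - ?a) * \<rho> (?a + ?D))" by simp
    also have "\<dots> \<le> C * (C * (tail ?a - tail (?a + ?D)))"
      using a C_ge_1 by (intro mult_left_mono tail_diff_ge) auto
    also have "\<dots> \<le> C * (C * (C * d\<^sub>\<rho> (\<gamma> t) (\<gamma> t')))"
      using C_ge_1 by (intro mult_left_mono d_ge M t) auto
    finally show ?thesis using C_ge_1 by (simp add: divide_le_eq power3_eq_cube mult_ac)
  qed
  obtain n where n: "(u - s) / \<delta> < real n" using reals_Archimedean2 by blast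
  then have n0: "0 < n" using su \<delta>(1) by (cases n) (auto simp: divide_less_0_iff)
  define t where "t i = s + real i * ((u - s) / real n)" for i
  have t: "t 0 = s" "t n = u" "mono_on {..n} t"
    using n0 su by (auto simp: t_def mono_on_def intro!: divide_right_mono mult_right_mono)
  have mesh: "dist (t (Suc i)) (t i) < \<delta>" for i
  proof -
    have "t (Suc i) - t i = (u - s) / real n"
      unfolding t_def of_nat_Suc distrib_right by simp
    moreover have "(u - s) / real n < \<delta>" using n n0 \<delta>(1) by (simp add: field_simps)
    ultimately show ?thesis using su n0 by (simp add: dist_real_def)
  qed
  have "\<rho> r / C ^ 3 * dist (\<gamma> s) (\<gamma> u) \<le> \<rho> r / C ^ 3 * (\<Sum>i<n. dist (\<gamma> (t i)) (\<gamma> (t (Suc i))))"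
  proof (rule mult_left_mono)
    show "dist (\<gamma> s) (\<gamma> u) \<le> (\<Sum>i<n. dist (\<gamma> (t i)) (\<gamma> (t (Suc i))))"
      using dist_le_sum_dist[of "\<lambda>i. \<gamma> (t i)" n] by (simp add: t)
    have "0 < r" using le_less_trans[OF norm_ge_zero inside[OF t0(1)]] .
    then show "0 \<le> \<rho> r / C ^ 3" using pos[of r] C_ge_1 by simp
  qed
  also have "\<dots> = (\<Sum>i<n. \<rho> r / C ^ 3 * dist (\<gamma> (t i)) (\<gamma> (t (Suc i))))" by (rule sum_distrib_left)
  also have "\<dots> \<le> (\<Sum>i<n. d\<^sub>\<rho> (\<gamma> (t i)) (\<gamma> (t (Suc i))))"
  proof (rule sum_mono)
    fix i assume "i \<in> {..<n}"
    then show "\<rho> r / C ^ 3 * dist (\<gamma> (t i)) (\<gamma> (t (Suc i))) \<le> d\<^sub>\<rho> (\<gamma> (t i)) (\<gamma> (t (Suc i)))"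
      by (intro step mesh R.partition_bounds[OF t]) auto
  qed
  finally have "ennreal (\<rho> r / C ^ 3 * dist (\<gamma> s) (\<gamma> u)) \<le> ennreal (\<Sum>i<n. d\<^sub>\<rho> (\<gamma> (t i)) (\<gamma> (t (Suc i))))"
    by (rule ennreal_leI)
  also have "\<dots> = (\<Sum>i<n. ennreal (d\<^sub>\<rho> (\<gamma> (t i)) (\<gamma> (t (Suc i)))))" by (simp add: sum_ennreal)
  also have "\<dots> \<le> R.curve_length s u \<gamma>" by (rule R.sum_le_curve_length[OF t])
  finally show ?thesis .
qed

text \<open>If \<open>tail R\<close> is small compared with \<open>R * \<rho> R\<close>, then \<open>tail (R / 2)\<close>, which exceeds it by at least
\<open>R * \<rho> R / (2 * C)\<close>, is larger than \<open>Q * tail R\<close>, and the intermediate value theorem gives \<open>r\<close> between \<open>R / 2\<close>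
and \<open>R\<close>.\<close>

lemma radii_exist:
  assumes small: "\<And>\<epsilon>. 0 < \<epsilon> \<Longrightarrow> \<exists>r>0. tail r < \<epsilon> * ((r + 1) * \<rho> r)"
    and \<epsilon>: "0 < \<epsilon>" and Q: "1 \<le> Q"
  obtains r R where "0 < r" "R / 2 \<le> r" "r \<le> R" "tail r = Q * tail R" "tail R < \<epsilon> * (R * \<rho> R)"
proof -
  have B: "0 < B" using bound[of 1] pos[of 1] by simp
  define \<epsilon>1 where "\<epsilon>1 = min \<epsilon> (1 / (2 * C * Q))"
  have \<epsilon>1: "0 < \<epsilon>1" "\<epsilon>1 \<le> \<epsilon>" "\<epsilon>1 * (2 * C * Q) \<le> 1"
    using \<epsilon> Q C_ge_1 by (auto simp: \<epsilon>1_def min_def field_simps)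
  define \<epsilon>2 where "\<epsilon>2 = min (\<epsilon>1 / 2) (tail 1 / (2 * B))"
  have \<epsilon>2: "0 < \<epsilon>2" "\<epsilon>2 \<le> \<epsilon>1 / 2" "\<epsilon>2 * (2 * B) \<le> tail 1"
    using \<epsilon>1 B tail_pos[of 1] by (auto simp: \<epsilon>2_def min_def field_simps)
  obtain R where R: "0 < R" "tail R < \<epsilon>2 * ((R + 1) * \<rho> R)" using small[OF \<epsilon>2(1)] by blast
  have \<rho>R: "0 < \<rho> R" by (rule pos[OF R(1)])
  \<comment> \<open>For radii up to \<open>1\<close> the quotient of \<open>tail R\<close> and \<open>(R + 1) * \<rho> R\<close> is at least \<open>tail 1 / (2 * B)\<close>. So the
    radius exceeds \<open>1\<close>, and \<open>R + 1\<close> may be replaced by \<open>2 * R\<close>.\<close>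
  have R1: "1 < R"
  proof (rule ccontr)
    assume "\<not> 1 < R"
    then have "tail 1 \<le> tail R" "(R + 1) * \<rho> R \<le> 2 * B"
      using R(1) bound[OF R(1)] \<rho>R by (auto intro!: tail_antimono mult_mono)
    moreover have "\<epsilon>2 * ((R + 1) * \<rho> R) \<le> \<epsilon>2 * (2 * B)"
      using \<epsilon>2 calculation(2) by (intro mult_left_mono) auto
    ultimately show False using R(2) \<epsilon>2(3) by linarith
  qed
  have small1: "tail R < \<epsilon>1 * (R * \<rho> R)"
  proof -
    have "\<epsilon>2 * ((R + 1) * \<rho> R) \<le> \<epsilon>1 / 2 * ((2 * R) * \<rho> R)"
      using \<epsilon>2 R1 \<rho>R by (intro mult_mono) auto
    then show ?thesis using R(2) by simp
  qed
  have "Q * tail R \<le> tail (R / 2)"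
  proof -
    have "2 * C * Q * tail R \<le> 2 * C * Q * (\<epsilon>1 * (R * \<rho> R))"
      using small1 C_ge_1 Q by (intro mult_left_mono) auto
    also have "\<dots> = (\<epsilon>1 * (2 * C * Q)) * (R * \<rho> R)" by simp
    also have "\<dots> \<le> 1 * (R * \<rho> R)" using \<epsilon>1(3) R \<rho>R by (intro mult_right_mono) auto
    also have "\<dots> = 2 * ((R - R / 2) * \<rho> R)" by (simp add: field_simps)
    also have "\<dots> \<le> 2 * (C * (tail (R / 2) - tail R))"
      using tail_diff_ge[of "R / 2" R] R by simp
    finally have "C * (Q * tail R) \<le> C * (tail (R / 2) - tail R)" by simp
    then show ?thesis using C_ge_1 tail_nonneg[of R] R by simp
  qed
  moreover have "tail R \<le> Q * tail R"
    using mult_right_mono[OF Q, of "tail R"] tail_nonneg[of R] R by simp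
  moreover have "continuous_on {R / 2..R} tail"
    by (rule continuous_on_subset[OF tail_continuous]) (use R in auto)
  ultimately obtain r where r: "R / 2 \<le> r" "r \<le> R" "tail r = Q * tail R"
    using IVT2'[of tail R "Q * tail R" "R / 2"] R by auto
  have "\<epsilon>1 * (R * \<rho> R) \<le> \<epsilon> * (R * \<rho> R)" using \<epsilon>1(2) R \<rho>R by (intro mult_right_mono) auto
  then have "tail R < \<epsilon> * (R * \<rho> R)" using small1 by linarith
  moreover have "0 < r" using r(1) R(1) by linarith
  ultimately show ?thesis using that r by blast
qed

text \<open>The constant \<open>Q\<close> defeats condition (ii) if the curve leaves the disc of radius \<open>R\<close>; the bound \<open>\<epsilon>\<close>, chosen
after \<open>Q\<close>, defeats condition (i) if it does not.\<close>

lemma not_uniform: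
  assumes small: "\<And>\<epsilon>. 0 < \<epsilon> \<Longrightarrow> \<exists>r>0. tail r < \<epsilon> * ((r + 1) * \<rho> r)"
  shows "\<not> R.uniform"
proof
  assume "R.uniform"
  then obtain K where K: "K \<ge> 1"
    and curves: "\<And>x y. x \<in> upper_half_plane \<Longrightarrow> y \<in> upper_half_plane \<Longrightarrow>
      \<exists>s u \<gamma>. R.curve s u \<gamma> \<and> \<gamma> s = x \<and> \<gamma> u = y \<and> R.uniform_curve K s u (R.completion_embed \<circ> \<gamma>)"
    unfolding R.uniform_def R.C_uniform_def by blast
  define Q where "Q = 2 + C * K"
  have Q: "1 \<le> Q" using K C_ge_1 by (simp add: Q_def add_increasing2)
  define \<epsilon> where "\<epsilon> = 1 / (4 * K * Q * C ^ 3)"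
  have \<epsilon>: "0 < \<epsilon>" using K Q C_ge_1 by (simp add: \<epsilon>_def)
  obtain r R where r: "0 < r" "R / 2 \<le> r" "r \<le> R" "tail r = Q * tail R" "tail R < \<epsilon> * (R * \<rho> R)"
    using radii_exist[OF small \<epsilon> Q] by metis
  have R0: "0 < R" using r by simp
  \<comment> \<open>The Pythagorean triple 3, 4, 5 places both points on the circle of radius \<open>r\<close>, at distance \<open>6 / 5 * r\<close>.\<close>
  define x where "x = (3 / 5 * r, 4 / 5 * r)"
  define y where "y = (- 3 / 5 * r, 4 / 5 * r)"
  have xy: "x \<in> upper_half_plane" "y \<in> upper_half_plane" using r by (auto simp: x_def y_def mem_upper_half_plane)
  have nx: "norm x = r" "norm y = r"
  proof -
    have "(3 / 5 * r)\<^sup>2 + (4 / 5 * r)\<^sup>2 = r\<^sup>2" "(- 3 / 5 * r)\<^sup>2 + (4 / 5 * r)\<^sup>2 = r\<^sup>2"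
      by (simp_all add: power2_eq_square field_simps)
    then show "norm x = r" "norm y = r" using r by (simp_all add: x_def y_def norm_Pair)
  qed
  have dxy: "dist x y = 6 / 5 * r" using r by (simp add: x_def y_def dist_Pair_Pair dist_real_def)
  obtain s u \<gamma> where \<gamma>: "R.curve s u \<gamma>" "\<gamma> s = x" "\<gamma> u = y" "R.uniform_curve K s u (R.completion_embed \<circ> \<gamma>)"
    using curves[OF xy] by blast
  have su: "s \<le> u" using \<gamma>(1) by (simp add: R.curve_def)
  have len: "R.curve_length s u \<gamma> \<le> ennreal K * ennreal (d\<^sub>\<rho> x y)"
    and cigar: "\<And>t. t \<in> {s..u} \<Longrightarrow> min (R.curve_length s t \<gamma>) (R.curve_length t u \<gamma>)
        \<le> ennreal K * (INF w \<in> R.metric_boundary. ennreal (R.completion_dist (R.completion_embed (\<gamma> t)) w))"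
    using \<gamma>(4) unfolding R.uniform_curve_embed_iff[OF \<gamma>(1)] \<gamma>(2,3) by auto
  show False
  proof (cases "\<exists>t\<in>{s..u}. R \<le> norm (\<gamma> t)")
    case True
    then obtain t where t: "t \<in> {s..u}" "R \<le> norm (\<gamma> t)" by blast
    have z: "\<gamma> t \<in> upper_half_plane" by (rule R.curve_in_M[OF \<gamma>(1) t(1)])
    have far: "(Q - 1) * tail R \<le> C * d\<^sub>\<rho> p (\<gamma> t)" if p: "p \<in> upper_half_plane" "norm p = r" for p
    proof -
      have "R \<le> norm p + dist p (\<gamma> t)"
        using t(2) norm_triangle_sub[of "\<gamma> t" p] by (simp add: dist_norm norm_minus_commute)
      then have "tail (norm p + dist p (\<gamma> t)) \<le> tail R" using R0 by (intro tail_antimono)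
      then show ?thesis using d_ge[OF p(1) z] by (simp add: p(2) r(4) algebra_simps)
    qed
    define m where "m = min (d\<^sub>\<rho> x (\<gamma> t)) (d\<^sub>\<rho> y (\<gamma> t))"
    have "(Q - 1) * tail R \<le> C * m" using far[OF xy(1) nx(1)] far[OF xy(2) nx(2)] by (simp add: m_def min_def)
    have "ennreal m \<le> min (R.curve_length s t \<gamma>) (R.curve_length t u \<gamma>)"
    proof (rule min.boundedI)
      have "ennreal m \<le> ennreal (d\<^sub>\<rho> x (\<gamma> t))" unfolding m_def by (intro ennreal_leI) simp
      also have "\<dots> \<le> R.curve_length s t \<gamma>"
        using R.dist_le_curve_length[of s t \<gamma>] t(1) by (simp add: \<gamma>(2))
      finally show "ennreal m \<le> R.curve_length s t \<gamma>" .
      have "ennreal m \<le> ennreal (d\<^sub>\<rho> (\<gamma> t) y)" unfolding m_def R.commute[of y] by (intro ennreal_leI) simp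
      also have "\<dots> \<le> R.curve_length t u \<gamma>"
        using R.dist_le_curve_length[of t u \<gamma>] t(1) by (simp add: \<gamma>(3))
      finally show "ennreal m \<le> R.curve_length t u \<gamma>" .
    qed
    also have "\<dots> \<le> ennreal K * (INF w \<in> R.metric_boundary. ennreal (R.completion_dist (R.completion_embed (\<gamma> t)) w))"
      by (rule cigar[OF t(1)])
    also have "\<dots> \<le> ennreal K * ennreal (tail (norm (\<gamma> t)))"
    proof (rule mult_left_mono)
      obtain \<omega> where "\<omega> \<in> R.metric_boundary" "R.completion_dist (R.completion_embed (\<gamma> t)) \<omega> \<le> tail (norm (\<gamma> t))"
        using infinity_in_boundary z by blast
      then show "(INF w \<in> R.metric_boundary. ennreal (R.completion_dist (R.completion_embed (\<gamma> t)) w))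
          \<le> ennreal (tail (norm (\<gamma> t)))"
        by (intro INF_lower2[of \<omega>] ennreal_leI)
    qed simp
    also have "\<dots> = ennreal (K * tail (norm (\<gamma> t)))"
      using K tail_nonneg[of "norm (\<gamma> t)"] by (intro ennreal_mult[symmetric]) auto
    finally have "m \<le> K * tail (norm (\<gamma> t))"
      using K tail_nonneg[of "norm (\<gamma> t)"] by (subst (asm) ennreal_le_iff) auto
    also have "\<dots> \<le> K * tail R" using K t(2) R0 by (intro mult_left_mono tail_antimono) auto
    finally have "C * m \<le> C * (K * tail R)" using C_ge_1 by (intro mult_left_mono) auto
    then have "(Q - 1) * tail R \<le> (C * K) * tail R" using \<open>(Q - 1) * tail R \<le> C * m\<close> by simp
    then have "Q - 1 \<le> C * K" using tail_pos[OF R0] by (rule mult_right_le_imp_le)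
    then show False by (simp add: Q_def)
  next
    case False
    then have inside: "norm (\<gamma> t) < R" if "t \<in> {s..u}" for t using that by (meson not_le)
    have "ennreal (\<rho> R / C ^ 3 * dist x y) \<le> ennreal K * ennreal (d\<^sub>\<rho> x y)"
      using order_trans[OF sphericalized_length_ge[OF \<gamma>(1) inside] len] by (simp add: \<gamma>(2,3))
    also have "\<dots> = ennreal (K * d\<^sub>\<rho> x y)" using K by (intro ennreal_mult[symmetric]) auto
    finally have "\<rho> R / C ^ 3 * dist x y \<le> K * d\<^sub>\<rho> x y"
      using K by (subst (asm) ennreal_le_iff) auto
    also have "\<dots> \<le> K * (2 * (Q * tail R))"
      using d_le_tails[OF xy] K by (intro mult_left_mono) (auto simp: nx r(4))
    also have "\<dots> < K * (2 * (Q * (\<epsilon> * (R * \<rho> R))))"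
      using r(5) K Q by simp
    also have "\<dots> = R * \<rho> R / (2 * C ^ 3)"
      using K Q C_ge_1 by (simp add: \<epsilon>_def field_simps)
    also have "\<dots> \<le> \<rho> R / C ^ 3 * dist x y"
    proof -
      have "\<rho> R / C ^ 3 * (R / 2) \<le> \<rho> R / C ^ 3 * dist x y"
        using r pos[OF R0] C_ge_1 by (intro mult_left_mono) (auto simp: dxy)
      then show ?thesis by (simp add: mult.commute)
    qed
    finally show False by simp
  qed
qed

end

theorem proposition3p8:
  fixes \<rho> :: "real \<Rightarrow> real"
  assumes "\<rho> \<in> borel_measurable (restrict_space borel {0<..})"
    and "\<And>t. t > 0 \<Longrightarrow> \<rho> t > 0"
    and "(\<integral>\<^sup>+ t \<in> {0<..}. ennreal (\<rho> t) \<partial>lborel) < \<infinity>"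
    and "bounded (\<rho> ` {0<..})"
    and "quasidecreasing \<rho>"
    and "(INF r \<in> {0<..}. (LBINT t:{r<..}. \<rho> t) / ((r + 1) * \<rho> r)) = 0"
  shows "Metric_space.C_uniform upper_half_plane dist (pi / 2) \<and>
    (let d\<^sub>\<rho> = Metric_space.sphericalized_dist upper_half_plane dist (0, 0) \<rho>
     in Metric_space upper_half_plane d\<^sub>\<rho> \<and> \<not> Metric_space.uniform upper_half_plane d\<^sub>\<rho>)"
proof -
  obtain B where B: "\<And>t. 0 < t \<Longrightarrow> \<bar>\<rho> t\<bar> \<le> B" using assms(4) by (auto simp: bounded_iff)
  obtain C where C: "C \<ge> 1" "\<And>s t. 0 < s \<Longrightarrow> s \<le> t \<Longrightarrow> \<rho> t \<le> C * \<rho> s"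
    using assms(5) unfolding quasidecreasing_def by blast
  interpret bounded_quasidecreasing_density \<rho> C B
    using assms(1-3) C B by unfold_locales (auto intro: order_trans[OF abs_ge_self])
  have "\<exists>r>0. tail r < \<epsilon> * ((r + 1) * \<rho> r)" if "0 < \<epsilon>" for \<epsilon>
  proof -
    let ?q = "\<lambda>r. tail r / ((r + 1) * \<rho> r)"
    have "(INF r\<in>{0<..}. ?q r) < \<epsilon>" using assms(6) that by (simp add: tail_def)
    moreover have "bdd_below (?q ` {0<..})"
      by (rule bdd_belowI2[of _ 0]) (use assms(2) tail_nonneg in \<open>auto intro!: divide_nonneg_nonneg simp: less_imp_le\<close>)
    ultimately obtain r where "0 < r" "?q r < \<epsilon>" by (subst (asm) cINF_less_iff) auto
    then show ?thesis using assms(2)[of r] by (intro exI[of _ r]) (simp add: divide_less_eq)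
  qed
  from not_uniform[OF this] show ?thesis
    using half_plane_C_uniform Metric_space_sphericalized by (simp add: Let_def)
qed

end
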